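(* Let $g\in W^{1,2}(\mathbb{S}^1,\mathbb{R}^2)$ with $I(g)=\int_{\mathbb{S}^1}W(\nabla u^g)\,d\theta<\infty$, where $W(F)=\frac12|F|^2+h(\det F)$, $h$ is as in the context, $f(t)=th'(t)-h(t)$ and $d=\det\nabla u^g$. Suppose $g$ satisfies, for all smooth $\varphi:\mathbb{S}^1\to\mathbb{R}$, $$\int_{\mathbb{S}^1}\Big(f(d)+\tfrac12|g'|^2-\tfrac12|g|^2\Big)\varphi'\,d\theta=0,$$ $$\int_{\mathbb{S}^1}\Big(|g'|^2+|g|^2+2d\,h'(d)\Big)\varphi+(g'\cdot g)\,\varphi'\,d\theta=0$$ (the integrands being integrable). Let $0<R_0<R_1$ and let $\mathfrak{a}$ be the annulus in $\mathbb{R}^2$ centred at $0$ with inner and outer radii $R_0,R_1$. Then the one-homogeneous map $u^g$ satisfies $$\int_{\mathfrak{a}}\Big\{\big(M(\nabla u^g)e_R+2W(\nabla u^g)e_R\big)\cdot\Phi+M(\nabla u^g)e_\theta\cdot\Phi_{,\theta}\Big\}\,\frac{dR\,d\theta}{R^2}=0$$ for all $\Phi\in C^1_c(\mathfrak{a},\mathbb{R}^2)$, where $M(F)=F^TDW(F)-W(F)\mathbf{1}$. Thus $u^g$ is a solution of the two-dimensional equilibrium equation associated with the functional $E(u)=\int_{\mathfrak{a}}\frac{1}{|x|^2}W(\nabla u)\,dx$.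
   Context: $h:\mathbb{R}\to(0,+\infty]$ satisfies: $h(t)=+\infty$ if $t\le 0$; $h(t)\to\infty$ as $t\to0+$; $h$ is positive, $C^2$ and strongly convex on $(0,\infty)$ (there is $\mu>0$ with $h''\ge\mu$). Functions on $\mathbb{S}^1$ are written as $2\pi$-periodic functions of the polar angle $\theta$, with $'=d/d\theta$. $(R,\theta)$ are polar coordinates, $e_R=(\cos\theta,\sin\theta)$, $e_\theta=(-\sin\theta,\cos\theta)$, $\Phi_{,\theta}$ is the $\theta$-derivative, and $\mathbf{1}$ is the $2\times2$ identity. $u^g(x)=|x|\,g(x/|x|)$, so $\nabla u^g=g\otimes e_R+g'\otimes e_\theta$ depends only on $\theta$ and $\det\nabla u^g=Jg\cdot g'$ with $J=\begin{pmatrix}0&-1\\1&0\end{pmatrix}$. The two-dimensional equilibrium equation associated with $E$ is $\int_{\mathfrak{a}}2W(\nabla u)\frac{x}{|x|^4}\cdot\Phi+\frac{1}{|x|^2}M(\nabla u)\cdot\nabla\Phi\,dx=0$ for all $\Phi\in C^1_c(\mathfrak{a},\mathbb{R}^2)$ (matrix inner product $X\cdot Y=\mathrm{tr}(X^TY)$); for one-homogeneous $u$ it takes the polar form displayed in the claim. *)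

theory Defs
  imports "HOL-Analysis.Analysis"
begin

subsection \<open>The convex function \<open>h\<close> and the stored-energy function\<close>

text \<open>\<open>h\<close> takes values in \<open>(0,\<infinity>]\<close>, modelled by \<^typ>\<open>ennreal\<close>. On \<open>(0,\<infinity>)\<close> it is finite, and
  derivatives are those of its real-valued version.\<close>

definition real_val :: "('a \<Rightarrow> ennreal) \<Rightarrow> 'a \<Rightarrow> real" where
  "real_val h t = enn2real (h t)"

definition admissible_h :: "(real \<Rightarrow> ennreal) \<Rightarrow> bool" where
  "admissible_h h \<longleftrightarrow>
     (\<forall>t\<le>0. h t = \<infinity>) \<and>
     (h \<longlongrightarrow> \<infinity>) (at_right 0) \<and>
     (\<forall>t>0. 0 < h t \<and> h t < \<infinity>) \<and>
     (\<forall>t>0. real_val h differentiable (at t)) \<and>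
     (\<forall>t>0. deriv (real_val h) differentiable (at t)) \<and>
     continuous_on {0<..} (deriv (deriv (real_val h))) \<and>
     (\<exists>\<mu>>0. \<forall>t>0. deriv (deriv (real_val h)) t \<ge> \<mu>)"

definition f_aux :: "(real \<Rightarrow> ennreal) \<Rightarrow> real \<Rightarrow> real" where
  "f_aux h t = t * deriv (real_val h) t - real_val h t"

text \<open>The norm and the inner product of \<^typ>\<open>real^2^2\<close> are the Frobenius ones.\<close>

definition W :: "(real \<Rightarrow> ennreal) \<Rightarrow> real^2^2 \<Rightarrow> ennreal" where
  "W h F = ennreal ((norm F)\<^sup>2 / 2) + h (det F)"

text \<open>\<open>DW\<close> and \<open>M\<close> are meaningful where \<open>W\<close> is finite, that is for \<open>det F > 0\<close>. Below they are
  only evaluated at gradient fields of finite energy, which have \<open>det > 0\<close> almost everywhere.\<close>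

definition DW :: "(real \<Rightarrow> ennreal) \<Rightarrow> real^2^2 \<Rightarrow> real^2^2" where
  "DW h F = (\<chi> i j. frechet_derivative (real_val (W h)) (at F) (axis i (axis j 1)))"

definition M :: "(real \<Rightarrow> ennreal) \<Rightarrow> real^2^2 \<Rightarrow> real^2^2" where
  "M h F = transpose F ** DW h F - real_val (W h) F *\<^sub>R mat 1"

subsection \<open>Functions on the circle\<close>

definition e_R :: "real \<Rightarrow> real^2" where
  "e_R \<theta> = vector [cos \<theta>, sin \<theta>]"

definition e_\<theta> :: "real \<Rightarrow> real^2" where
  "e_\<theta> \<theta> = vector [- sin \<theta>, cos \<theta>]"

definition periodic_2pi :: "(real \<Rightarrow> 'a) \<Rightarrow> bool" where
  "periodic_2pi g \<longleftrightarrow> (\<forall>\<theta>. g (\<theta> + 2 * pi) = g \<theta>)"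

definition smooth_circle :: "(real \<Rightarrow> real) \<Rightarrow> bool" where
  "smooth_circle \<phi> \<longleftrightarrow>
     periodic_2pi \<phi> \<and> (\<forall>n \<theta>. ((deriv ^^ n) \<phi>) differentiable (at \<theta>))"

text \<open>\<open>g\<close> is in \<open>W\<^sup>1\<^sup>,\<^sup>2\<close> of the circle and \<open>g'\<close> is (a Borel representative of) its weak
  derivative.\<close>

definition W12_circle :: "(real \<Rightarrow> real^2) \<Rightarrow> (real \<Rightarrow> real^2) \<Rightarrow> bool" where
  "W12_circle g g' \<longleftrightarrow>
     periodic_2pi g \<and> periodic_2pi g' \<and>
     g \<in> borel_measurable borel \<and> g' \<in> borel_measurable borel \<and>
     set_integrable lborel {0..2*pi} (\<lambda>\<theta>. (norm (g \<theta>))\<^sup>2) \<and>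
     set_integrable lborel {0..2*pi} (\<lambda>\<theta>. (norm (g' \<theta>))\<^sup>2) \<and>
     (\<forall>\<phi>. smooth_circle \<phi> \<longrightarrow>
        (LINT \<theta>:{0..2*pi}|lborel. deriv \<phi> \<theta> *\<^sub>R g \<theta>)
        = - (LINT \<theta>:{0..2*pi}|lborel. \<phi> \<theta> *\<^sub>R g' \<theta>))"

definition outer :: "real^2 \<Rightarrow> real^2 \<Rightarrow> real^2^2" (infixl "\<otimes>\<^sub>o" 70) where
  "a \<otimes>\<^sub>o b = (\<chi> i j. a $ i * b $ j)"

definition one_hom :: "(real \<Rightarrow> real^2) \<Rightarrow> real^2 \<Rightarrow> real^2" where
  "one_hom g x = norm x *\<^sub>R g (Arg2pi (Complex (x $ 1) (x $ 2)))"

text \<open>The gradient of \<open>one_hom g\<close> in terms of the polar angle.\<close>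

definition grad_one_hom :: "(real \<Rightarrow> real^2) \<Rightarrow> (real \<Rightarrow> real^2) \<Rightarrow> real \<Rightarrow> real^2^2" where
  "grad_one_hom g g' \<theta> = g \<theta> \<otimes>\<^sub>o e_R \<theta> + g' \<theta> \<otimes>\<^sub>o e_\<theta> \<theta>"

definition I_energy ::
    "(real \<Rightarrow> ennreal) \<Rightarrow> (real \<Rightarrow> real^2) \<Rightarrow> (real \<Rightarrow> real^2) \<Rightarrow> ennreal" where
  "I_energy h g g' = (\<integral>\<^sup>+\<theta>\<in>{0..2*pi}. W h (grad_one_hom g g' \<theta>) \<partial>lborel)"

subsection \<open>The equilibrium equation on an annulus\<close>

definition annulus :: "real \<Rightarrow> real \<Rightarrow> (real^2) set" where
  "annulus R0 R1 = {x. R0 < norm x \<and> norm x < R1}"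

text \<open>\<open>C\<^sup>1\<close> functions with compact support in \<open>\<Omega>\<close>, extended by zero outside \<open>\<Omega>\<close>.\<close>

definition C1c :: "(real^2) set \<Rightarrow> (real^2 \<Rightarrow> 'b::real_normed_vector) set" where
  "C1c \<Omega> = {\<Phi>. (\<forall>x. \<Phi> differentiable (at x)) \<and>
       (\<forall>v. continuous_on UNIV (\<lambda>x. frechet_derivative \<Phi> (at x) v)) \<and>
       (\<exists>K. compact K \<and> K \<subseteq> \<Omega> \<and> (\<forall>x. x \<notin> K \<longrightarrow> \<Phi> x = 0))}"

definition has_weak_gradient ::
    "(real^2 \<Rightarrow> real^2) \<Rightarrow> (real^2 \<Rightarrow> real^2^2) \<Rightarrow> (real^2) set \<Rightarrow> bool" where
  "has_weak_gradient u G \<Omega> \<longleftrightarrow>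
     (\<forall>K. compact K \<and> K \<subseteq> \<Omega> \<longrightarrow> set_integrable lborel K u \<and> set_integrable lborel K G) \<and>
     (\<forall>\<eta>\<in>C1c \<Omega>. \<forall>i j.
        (LINT x:\<Omega>|lborel. u x $ i * frechet_derivative \<eta> (at x) (axis j 1))
        = - (LINT x:\<Omega>|lborel. G x $ i $ j * \<eta> x))"

text \<open>The functional \<open>E\<close>, as a function of the gradient field.\<close>

definition E_energy :: "(real \<Rightarrow> ennreal) \<Rightarrow> (real^2) set \<Rightarrow> (real^2 \<Rightarrow> real^2^2) \<Rightarrow> ennreal" where
  "E_energy h \<Omega> G = (\<integral>\<^sup>+x\<in>\<Omega>. ennreal (1 / (norm x)\<^sup>2) * W h (G x) \<partial>lborel)"

text \<open>Finiteness of \<open>E\<close> forces \<open>det G > 0\<close> almost everywhere, so that the integrand of the weak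
  equation is meaningful.\<close>

definition equilibrium_solution ::
    "(real \<Rightarrow> ennreal) \<Rightarrow> (real^2) set \<Rightarrow> (real^2 \<Rightarrow> real^2) \<Rightarrow> bool" where
  "equilibrium_solution h \<Omega> u \<longleftrightarrow>
     (\<exists>G. has_weak_gradient u G \<Omega> \<and> E_energy h \<Omega> G < \<infinity> \<and>
       (\<forall>\<Phi>\<in>C1c \<Omega>.
          let integrand = (\<lambda>x. ((2 * real_val (W h) (G x) / norm x ^ 4) *\<^sub>R x) \<bullet> \<Phi> x
                + (1 / (norm x)\<^sup>2) * (M h (G x) \<bullet> jacobian \<Phi> (at x)))
          in set_integrable lborel \<Omega> integrand \<and> (LINT x:\<Omega>|lborel. integrand x) = 0))"

end

theory Submission
  imports Defs
begin

text \<open>Since \<open>M(F) = F\<^sup>T F + (f(det F) - |F|\<^sup>2/2) 1\<close> for \<open>det F > 0\<close>, the matrix \<open>M(\<nabla>u\<^sup>g)\<close> has in the frame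
  \<open>(e_R, e_\<theta>)\<close> entries depending on \<open>\<theta>\<close> only. Writing \<open>\<Phi> = p e_R + q e_\<theta>\<close>, the integrand of the polar
  equation becomes \<open>(A q' + (B p' + C p)) / R\<^sup>2\<close> with \<open>A = f(d) + |g'|\<^sup>2/2 - |g|\<^sup>2/2\<close>, \<open>B = g' \<bullet> g\<close> and
  \<open>C = |g'|\<^sup>2 + |g|\<^sup>2 + 2 d h'(d)\<close>. For each radius its \<open>\<theta>\<close>-integral vanishes by the two equations on the
  circle, which extend from smooth to \<open>C\<^sup>1\<close> test functions because trigonometric polynomials are
  \<open>C\<^sup>1\<close>-dense. The Cartesian equation differs from the polar one by
  \<open>M(\<nabla>u\<^sup>g) e_R \<bullet> \<partial>\<^sub>R (\<Phi> / R)\<close>, which integrates to zero in \<open>R\<close>. The weak gradient of \<open>u\<^sup>g\<close> is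
  found in the same way.\<close>

text \<open>The coefficients \<open>A\<close>, \<open>B\<close>, \<open>C\<close> are merely
  integrable in \<theta>, so derivatives always stay on the test side: integration by parts takes
  place in \<open>R\<close> only, where the coefficients are constant, and in \<theta> the weak
  equations replace it. The density argument is forced because the restriction of a C^1 field to a
  circle of fixed radius is only C^1, while the equations are given for smooth functions. The shape
  of the frame equation comes from p' = e_R . Phi_\<theta> + e_\<theta> . Phi and q' = e_\<theta> .
  Phi_\<theta> - e_R . Phi, together with f(d) + h(d) = d h'(d). The extra radial term comes from
  the area element: R times R^(-2) M . grad Phi equals M e_R . Phi_R / R + M e_\<theta> .
  Phi_\<theta> / R^2, whereas the polar form carries M e_R . Phi / R^2 in place of M e_R . Phi_R /
  R. A separate obstacle is measurability: \<open>DW\<close> is built from a choice operator and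
  from a real version of an extended-valued function, so its values must be controlled for every
  sign of the determinant.\<close>

subsection \<open>Test functions on the circle\<close>

text \<open>Generated by products instead of spanned by cos(nt) and sin(nt): polynomials in
  \<open>cis t\<close> then fall into the class by induction, and closure under differentiation is
  just the product rule.\<close>

inductive trig_polynomial :: "(real \<Rightarrow> real) \<Rightarrow> bool" where
  const: "trig_polynomial (\<lambda>t. c)"
| cos: "trig_polynomial cos"
| sin: "trig_polynomial sin"
| add: "trig_polynomial p \<Longrightarrow> trig_polynomial q \<Longrightarrow> trig_polynomial (\<lambda>t. p t + q t)"
| mult: "trig_polynomial p \<Longrightarrow> trig_polynomial q \<Longrightarrow> trig_polynomial (\<lambda>t. p t * q t)"

lemma trig_polynomial_periodic:
  "trig_polynomial p \<Longrightarrow> p (t + 2 * pi) = p t"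
  by (induction rule: trig_polynomial.induct) auto

lemma trig_polynomial_has_derivative:
  "trig_polynomial p \<Longrightarrow> \<exists>q. trig_polynomial q \<and> (\<forall>t. (p has_real_derivative q t) (at t))"
proof (induction rule: trig_polynomial.induct)
  case (const c)
  then show ?case by (intro exI[of _ "\<lambda>t. 0"]) (auto intro: trig_polynomial.const)
next
  case cos
  have "trig_polynomial (\<lambda>t. (-1) * sin t)"
    by (intro trig_polynomial.intros)
  then show ?case
    by (intro exI[of _ "\<lambda>t. (-1) * sin t"]) (auto intro!: derivative_eq_intros)
next
  case sin
  then show ?case
    by (intro exI[of _ cos]) (auto intro!: derivative_eq_intros trig_polynomial.intros)
next
  case (add p q)
  then obtain p' q' where "trig_polynomial p'" "\<And>t. (p has_real_derivative p' t) (at t)"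
      "trig_polynomial q'" "\<And>t. (q has_real_derivative q' t) (at t)"
    by blast
  then show ?case
    by (intro exI[of _ "\<lambda>t. p' t + q' t"]) (auto intro!: derivative_eq_intros trig_polynomial.intros)
next
  case (mult p q)
  then obtain p' q' where "trig_polynomial p'" "\<And>t. (p has_real_derivative p' t) (at t)"
      "trig_polynomial q'" "\<And>t. (q has_real_derivative q' t) (at t)"
    by blast
  with mult show ?case
    by (intro exI[of _ "\<lambda>t. p t * q' t + p' t * q t"])
       (auto intro!: derivative_eq_intros trig_polynomial.intros)
qed

lemma trig_polynomial_deriv:
  assumes "trig_polynomial p"
  shows "trig_polynomial (deriv p)" "(p has_real_derivative deriv p t) (at t)"
proof -
  obtain q where q: "trig_polynomial q" "\<And>t. (p has_real_derivative q t) (at t)"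
    using trig_polynomial_has_derivative[OF assms] by blast
  then have "deriv p = q"
    by (auto simp: DERIV_imp_deriv)
  with q show "trig_polynomial (deriv p)" "(p has_real_derivative deriv p t) (at t)"
    by auto
qed

lemma trig_polynomial_iterated_deriv: "trig_polynomial p \<Longrightarrow> trig_polynomial ((deriv ^^ n) p)"
  by (induction n) (auto intro: trig_polynomial_deriv)

text \<open>Meant for antiderivatives of trigonometric polynomials. Periodicity is a separate
  hypothesis because integration destroys it unless the mean is zero; all derivatives from the first
  on are trigonometric polynomials.\<close>

lemma smooth_circleI:
  assumes deriv: "\<And>t. (f has_real_derivative p t) (at t)" and p: "trig_polynomial p"
    and per: "\<And>t. f (t + 2 * pi) = f t"
  shows "smooth_circle f"
proof -
  have "deriv f = p"
    using deriv by (auto simp: DERIV_imp_deriv)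
  moreover have "((deriv ^^ n) p) differentiable (at t)" for n t
    using trig_polynomial_deriv(2)[OF trig_polynomial_iterated_deriv[OF p]]
    by (auto simp: real_differentiable_def)
  ultimately have "((deriv ^^ n) f) differentiable (at t)" for n t
    using deriv by (cases n) (auto simp: funpow_swap1 real_differentiable_def)
  with per show ?thesis
    by (auto simp: smooth_circle_def periodic_2pi_def)
qed

lemma trig_polynomial_smooth_circle: "trig_polynomial p \<Longrightarrow> smooth_circle p"
  by (rule smooth_circleI[of _ "deriv p"])
     (auto intro: trig_polynomial_deriv simp: trig_polynomial_periodic)

lemma trig_polynomial_comp_cis:
  "real_polynomial_function p \<Longrightarrow> trig_polynomial (\<lambda>t. p (cis t))"
proof (induction rule: real_polynomial_function.induct)
  case (linear f)
  then interpret bounded_linear f .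
  have "f (cis t) = cos t * f 1 + sin t * f \<i>" for t
  proof -
    have "cis t = cos t *\<^sub>R 1 + sin t *\<^sub>R \<i>"
      by (simp add: complex_eq_iff)
    then show ?thesis by (simp add: add scaleR)
  qed
  then show ?case
    by (auto intro!: trig_polynomial.intros)
qed (auto intro: trig_polynomial.intros)

text \<open>A periodic continuous function is a continuous function \<open>k\<close> on the unit
  circle, where the Stone-Weierstrass theorem provides a polynomial; pulling it back along
  \<open>cis\<close> gives \<open>p\<close>.\<close>

lemma periodic_dense_trig_polynomial:
  fixes c :: "real \<Rightarrow> real"
  assumes cont: "continuous_on UNIV c" and per: "\<And>t. c (t + 2 * pi) = c t" and "0 < e"
  obtains p where "trig_polynomial p" "\<And>t. \<bar>c t - p t\<bar> < e"
proof -
  define k where "k z = c (Arg2pi z)" for z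
  have per_int: "c (t + of_int n * (2 * pi)) = c t" for t n
  proof (induction n rule: int_induct[where k = 0])
    case (step1 i)
    then show ?case using per[of "t + of_int i * (2 * pi)"] by (simp add: algebra_simps)
  next
    case (step2 i)
    then show ?case using per[of "t + of_int (i - 1) * (2 * pi)"] by (simp add: algebra_simps)
  qed simp
  have k_cis: "k (cis t) = c t" for t
  proof -
    have "cis (Arg2pi (cis t)) = cis t"
      using Arg2pi_eq[of "cis t"] by (simp add: cis_conv_exp)
    then have "sin (Arg2pi (cis t)) = sin t \<and> cos (Arg2pi (cis t)) = cos t"
      by (simp add: complex_eq_iff)
    then obtain n where "Arg2pi (cis t) = t + of_int n * (2 * pi)"
      unfolding sin_cos_eq_iff by (auto simp: algebra_simps)
    then show ?thesis by (simp add: k_def per_int)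
  qed
  have sphere: "\<exists>t\<in>{0..2 * pi}. z = cis t" if "z \<in> sphere 0 1" for z :: complex
  proof
    show "z = cis (Arg2pi z)"
      using that Arg2pi_eq[of z] by (simp add: cis_conv_exp)
    show "Arg2pi z \<in> {0..2 * pi}"
      using Arg2pi[of z] by auto
  qed
  \<comment> \<open>\<open>Arg2pi\<close> jumps across the positive real axis, so continuity of
    \<open>k\<close> is not inherited by composition. Instead \<open>cis\<close> acts as a quotient
    map: the preimage of a closed set under \<open>k\<close> is the \<open>cis\<close>-image of a
    compact subset of \<open>{0..2 * pi}\<close>.\<close>
  have "continuous_on (sphere 0 1) k"
    unfolding continuous_on_closed_vimage[OF closed_sphere]
  proof (intro allI impI)
    fix T :: "real set" assume T: "closed T"
    have eq: "k -` T \<inter> sphere 0 1 = cis ` ({0..2 * pi} \<inter> c -` T)"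
      using sphere by (fastforce simp: k_cis)
    have "closed (c -` T)"
      using continuous_on_closed_vimage[OF closed_UNIV, of c] cont T by auto
    then have "compact ({0..2 * pi} \<inter> c -` T)"
      by (intro compact_Int_closed) auto
    then have "compact (cis ` ({0..2 * pi} \<inter> c -` T))"
      by (intro compact_continuous_image) (auto intro!: continuous_intros)
    then show "closed (k -` T \<inter> sphere 0 1)"
      unfolding eq by (rule compact_imp_closed)
  qed
  then obtain q where q: "real_polynomial_function q" "\<And>z. z \<in> sphere 0 1 \<Longrightarrow> \<bar>k z - q z\<bar> < e"
    using Stone_Weierstrass_real_polynomial_function[of "sphere 0 1" k e] \<open>0 < e\<close> by auto
  show thesis
  proof (rule that)
    show "trig_polynomial (\<lambda>t. q (cis t))"
      by (rule trig_polynomial_comp_cis[OF q(1)])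
    show "\<bar>c t - q (cis t)\<bar> < e" for t
      using q(2)[of "cis t"] by (simp add: k_cis)
  qed
qed

lemma continuous_has_antiderivative:
  fixes f :: "real \<Rightarrow> real"
  assumes "continuous_on UNIV f"
  obtains F where "\<And>t. (F has_real_derivative f t) (at t)"
proof
  fix t :: real
  have "((\<lambda>u. LBINT y=0..u. f y) has_vector_derivative f t) (at t within {- \<bar>t\<bar> - 1..\<bar>t\<bar> + 1})"
    using interval_integral_FTC2[of "- \<bar>t\<bar> - 1" 0 "\<bar>t\<bar> + 1" f t] continuous_on_subset[OF assms]
    by (auto simp: zero_ereal_def)
  moreover have "at t within {- \<bar>t\<bar> - 1..\<bar>t\<bar> + 1} = at t"
    by (rule at_within_interior) auto
  ultimately show "((\<lambda>u. LBINT y=0..u. f y) has_real_derivative f t) (at t)"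
    by (simp add: has_real_derivative_iff_has_vector_derivative)
qed

text \<open>The derivative is approximated first and then integrated, since uniform closeness passes
  from derivatives to functions on a bounded interval but not back.\<close>

lemma C1_circle_approx_smooth_circle:
  fixes \<phi> \<phi>' :: "real \<Rightarrow> real"
  assumes deriv: "\<And>t. (\<phi> has_real_derivative \<phi>' t) (at t)" and cont: "continuous_on UNIV \<phi>'"
    and per: "\<And>t. \<phi> (t + 2 * pi) = \<phi> t" and "0 < e"
  shows "\<exists>\<psi>. smooth_circle \<psi> \<and> (\<forall>t\<in>{0..2 * pi}. \<bar>\<phi> t - \<psi> t\<bar> \<le> e) \<and> (\<forall>t. \<bar>\<phi>' t - deriv \<psi> t\<bar> \<le> e)"
proof -
  \<comment> \<open>Two demands are met at once: 2 \<delta> bounds the error of the derivative, and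
    2 \<delta> times the period bounds the error of the function.\<close>
  define \<delta> where "\<delta> = e / (2 + 4 * pi)"
  have "0 < 2 + 4 * pi"
    using pi_gt_zero by linarith
  then have \<delta>: "0 < \<delta>" "\<delta> * (2 + 4 * pi) = e"
    using \<open>0 < e\<close> by (simp_all add: \<delta>_def)
  have "\<delta> * (2 + 4 * pi) = 2 * \<delta> + 4 * (\<delta> * pi)" "2 * \<delta> * (2 * pi) = 4 * (\<delta> * pi)" "0 < \<delta> * pi"
    using \<delta>(1) by (simp_all add: algebra_simps)
  then have "2 * \<delta> * (2 * pi) \<le> e" "2 * \<delta> \<le> e"
    using \<delta> by linarith+
  note \<delta> = \<delta> this
  have per': "\<phi>' (t + 2 * pi) = \<phi>' t" for t
  proof -
    have "((\<lambda>s. \<phi> (s + 2 * pi)) has_real_derivative \<phi>' (t + 2 * pi)) (at t)"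
      using deriv[of "t + 2 * pi"] by (simp add: DERIV_shift)
    then show ?thesis
      using deriv[of t] per DERIV_unique by auto
  qed
  obtain p where p: "trig_polynomial p" "\<And>t. \<bar>\<phi>' t - p t\<bar> < \<delta>"
    using periodic_dense_trig_polynomial[OF cont per' \<delta>(1)] by metis
  have "continuous_on UNIV p"
    using trig_polynomial_deriv(2)[OF p(1)] DERIV_isCont continuous_at_imp_continuous_on by blast
  then obtain P where P: "\<And>t. (P has_real_derivative p t) (at t)"
    using continuous_has_antiderivative by blast
  \<comment> \<open>\<open>m\<close> is the mean of \<open>p\<close> over a period; removing it
    makes the antiderivative periodic.\<close>
  define m where "m = (P (2 * pi) - P 0) / (2 * pi)"
  define \<psi> where "\<psi> t = \<phi> 0 + (P t - P 0 - m * t)" for t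
  have d\<psi>: "(\<psi> has_real_derivative p t + (- m)) (at t)" for t
    unfolding \<psi>_def by (auto intro!: derivative_eq_intros P)
  \<comment> \<open>The mean of \<phi>' is zero by periodicity of \<phi>, so \<open>m\<close> is a
    mean of \<open>p - \<phi>'\<close> and hence is attained at some \<open>z\<close>; this is why
    removing it costs at most another \<delta>.\<close>
  have "\<exists>z. 0 < z \<and> z < 2 * pi \<and> (P (2 * pi) - \<phi> (2 * pi)) - (P 0 - \<phi> 0) = (2 * pi - 0) * (p z - \<phi>' z)"
    using MVT2[of 0 "2 * pi" "\<lambda>t. P t - \<phi> t" "\<lambda>t. p t - \<phi>' t"]
    by (auto intro!: derivative_eq_intros P deriv)
  then obtain z where "P (2 * pi) - P 0 = 2 * pi * (p z - \<phi>' z)"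
    using per[of 0] by auto
  then have "m = p z - \<phi>' z"
    by (simp add: m_def)
  then have m: "\<bar>m\<bar> \<le> \<delta>"
    using p(2)[of z] by linarith
  have diff: "\<bar>\<phi>' t - (p t + - m)\<bar> \<le> 2 * \<delta>" for t
    using p(2)[of t] m by linarith
  have "\<psi> (t + 2 * pi) = \<psi> t" for t
  proof -
    have "((\<lambda>s. \<psi> (s + 2 * pi) - \<psi> s) has_real_derivative 0) (at s)" for s
    proof -
      have "((\<lambda>s. \<psi> (s + 2 * pi)) has_real_derivative p s + (- m)) (at s)"
        using d\<psi>[of "s + 2 * pi"] trig_polynomial_periodic[OF p(1)] by (simp add: DERIV_shift)
      from DERIV_diff[OF this d\<psi>] show ?thesis by simp
    qed
    then have "\<psi> (t + 2 * pi) - \<psi> t = \<psi> (0 + 2 * pi) - \<psi> 0"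
      using DERIV_isconst_all by blast
    also have "\<dots> = 0"
      by (simp add: \<psi>_def m_def)
    finally show ?thesis by simp
  qed
  moreover have "trig_polynomial (\<lambda>t. p t + (- m))"
    by (intro trig_polynomial.intros p)
  ultimately have "smooth_circle \<psi>"
    by (intro smooth_circleI[OF d\<psi>])
  moreover have "\<bar>\<phi> t - \<psi> t\<bar> \<le> e" if "t \<in> {0..2 * pi}" for t
  proof (cases "t = 0")
    case False
    have "\<exists>z. 0 < z \<and> z < t \<and> (\<phi> t - \<psi> t) - (\<phi> 0 - \<psi> 0) = (t - 0) * (\<phi>' z - (p z + - m))"
      using False that by (intro MVT2) (auto intro!: derivative_eq_intros d\<psi> deriv)
    then obtain z where "\<phi> t - \<psi> t = t * (\<phi>' z - (p z + - m))"
      by (auto simp: \<psi>_def)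
    then have "\<bar>\<phi> t - \<psi> t\<bar> = \<bar>t\<bar> * \<bar>\<phi>' z - (p z + - m)\<bar>"
      by (simp only: abs_mult)
    also have "\<dots> \<le> (2 * pi) * (2 * \<delta>)"
      using that diff[of z] by (intro mult_mono) auto
    also have "\<dots> \<le> e" using \<delta> by (simp add: mult.commute)
    finally show ?thesis .
  qed (use \<open>0 < e\<close> in \<open>simp add: \<psi>_def\<close>)
  moreover have "\<bar>\<phi>' t - deriv \<psi> t\<bar> \<le> e" for t
    using DERIV_imp_deriv[OF d\<psi>] diff[of t] \<delta> by simp
  ultimately show ?thesis by blast
qed

section \<open>Weak equations on the circle: from smooth to C^1 test functions\<close>

lemma set_integrable_continuous_scaleR:
  fixes f :: "real \<Rightarrow> 'b::{banach, second_countable_topology}" and c :: "real \<Rightarrow> real"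
  assumes f: "set_integrable lborel {0..2*pi} f" and c: "continuous_on {0..2*pi} c"
  shows "set_integrable lborel {0..2*pi} (\<lambda>t. c t *\<^sub>R f t)"
proof -
  obtain B where B: "\<forall>t\<in>{0..2*pi}. norm (c t) \<le> B"
    using compact_continuous_image[OF c] by (meson bounded_iff compact_Icc compact_imp_bounded imageI)
  have bound: "integrable lborel (\<lambda>t. B *\<^sub>R (indicator {0..2*pi} t *\<^sub>R f t))"
    using f unfolding set_integrable_def by (rule integrable_scaleR_right)
  have [measurable]: "(\<lambda>t. indicator {0..2*pi} t *\<^sub>R f t) \<in> borel_measurable borel"
    using f by (auto simp: set_integrable_def dest: borel_measurable_integrable)
  have [measurable]: "(\<lambda>t. indicator {0..2*pi} t *\<^sub>R c t) \<in> borel_measurable borel"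
    by (intro borel_measurable_continuous_on_indicator c) auto
  have eq: "(\<lambda>t. indicator {0..2*pi} t *\<^sub>R (c t *\<^sub>R f t))
      = (\<lambda>t. (indicator {0..2*pi} t *\<^sub>R c t) *\<^sub>R (indicator {0..2*pi} t *\<^sub>R f t))"
    by (auto simp: indicator_def)
  have meas: "(\<lambda>t. indicator {0..2*pi} t *\<^sub>R (c t *\<^sub>R f t)) \<in> borel_measurable lborel"
    unfolding eq by measurable
  have "norm (indicator {0..2*pi} t *\<^sub>R (c t *\<^sub>R f t)) \<le> norm (B *\<^sub>R (indicator {0..2*pi} t *\<^sub>R f t))" for t
  proof (cases "t \<in> {0..2*pi}")
    case True
    then have "\<bar>c t\<bar> \<le> \<bar>B\<bar>" using bspec[OF B True] by simp
    then show ?thesis using True by (simp add: mult_right_mono)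
  qed simp
  then show ?thesis
    unfolding set_integrable_def by (intro Bochner_Integration.integrable_bound[OF bound meas]) simp
qed

lemma smooth_circle_continuous:
  assumes "smooth_circle \<phi>"
  shows "continuous_on S \<phi>" "continuous_on S (deriv \<phi>)"
proof -
  have "continuous_on S ((deriv ^^ n) \<phi>)" for n
    using assms unfolding smooth_circle_def
    by (intro continuous_at_imp_continuous_on) (blast intro: differentiable_imp_continuous_within)
  from this[of 0] this[of "Suc 0"] show "continuous_on S \<phi>" "continuous_on S (deriv \<phi>)"
    by simp_all
qed

text \<open>The left-hand side is a functional of the test function bounded by its C^1 norm times
  the L^1 norm of the coefficients, so it vanishes on the C^1 closure of the smooth
  functions.\<close>

lemma weak_equation_C1_circle:
  fixes k l \<phi> \<phi>' :: "real \<Rightarrow> real"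
  assumes k: "set_integrable lborel {0..2*pi} k" and l: "set_integrable lborel {0..2*pi} l"
    and weak: "\<And>\<psi>. smooth_circle \<psi> \<Longrightarrow> (LINT t:{0..2*pi}|lborel. k t * deriv \<psi> t + l t * \<psi> t) = 0"
    and deriv: "\<And>t. (\<phi> has_real_derivative \<phi>' t) (at t)" and cont: "continuous_on UNIV \<phi>'"
    and per: "\<And>t. \<phi> (t + 2 * pi) = \<phi> t"
  shows "(LINT t:{0..2*pi}|lborel. k t * \<phi>' t + l t * \<phi> t) = 0"
proof -
  define I where "I = (LINT t:{0..2*pi}|lborel. \<bar>k t\<bar> + \<bar>l t\<bar>)"
  have int_mult: "set_integrable lborel {0..2*pi} (\<lambda>t. f t * c t)"
    if "set_integrable lborel {0..2*pi} f" "continuous_on UNIV c" for f c :: "real \<Rightarrow> real"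
    using set_integrable_continuous_scaleR[OF that(1) continuous_on_subset[OF that(2)]]
    by (simp add: mult.commute)
  have cont0: "continuous_on UNIV \<phi>"
    using deriv DERIV_isCont continuous_at_imp_continuous_on by blast
  have I: "set_integrable lborel {0..2*pi} (\<lambda>t. \<bar>k t\<bar> + \<bar>l t\<bar>)"
    using k l by (intro set_integral_add set_integrable_abs)
  have bound: "\<bar>LINT t:{0..2*pi}|lborel. k t * \<phi>' t + l t * \<phi> t\<bar> \<le> e * I" if "0 < e" for e
  proof -
    obtain \<psi> where \<psi>: "smooth_circle \<psi>" "\<And>t. t \<in> {0..2 * pi} \<Longrightarrow> \<bar>\<phi> t - \<psi> t\<bar> \<le> e"
        "\<And>t. \<bar>\<phi>' t - deriv \<psi> t\<bar> \<le> e"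
      using C1_circle_approx_smooth_circle[where \<phi> = \<phi>, OF deriv cont per \<open>0 < e\<close>] by blast
    note c = smooth_circle_continuous[OF \<psi>(1)]
    note i1 = set_integral_add(1)[OF int_mult[OF k cont] int_mult[OF l cont0]]
    note i2 = set_integral_add(1)[OF int_mult[OF k c(2)] int_mult[OF l c(1)]]
    have "\<bar>LINT t:{0..2*pi}|lborel. k t * \<phi>' t + l t * \<phi> t\<bar>
        = \<bar>LINT t:{0..2*pi}|lborel. (k t * \<phi>' t + l t * \<phi> t) - (k t * deriv \<psi> t + l t * \<psi> t)\<bar>"
      using set_integral_diff(2)[OF i1 i2] weak[OF \<psi>(1)] by simp
    also have "\<dots> \<le> (LINT t:{0..2*pi}|lborel. \<bar>(k t * \<phi>' t + l t * \<phi> t) - (k t * deriv \<psi> t + l t * \<psi> t)\<bar>)"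
      using set_integral_norm_bound[OF set_integral_diff(1)[OF i1 i2]] by simp
    also have "\<dots> \<le> (LINT t:{0..2*pi}|lborel. e * (\<bar>k t\<bar> + \<bar>l t\<bar>))"
    proof (rule set_integral_mono)
      show "set_integrable lborel {0..2*pi} (\<lambda>t. \<bar>(k t * \<phi>' t + l t * \<phi> t) - (k t * deriv \<psi> t + l t * \<psi> t)\<bar>)"
        by (intro set_integrable_abs set_integral_diff i1 i2)
      show "set_integrable lborel {0..2*pi} (\<lambda>t. e * (\<bar>k t\<bar> + \<bar>l t\<bar>))"
        by (intro set_integrable_mult_right I)
      fix t assume t: "t \<in> {0..2*pi}"
      have "\<bar>(k t * \<phi>' t + l t * \<phi> t) - (k t * deriv \<psi> t + l t * \<psi> t)\<bar>
          = \<bar>k t * (\<phi>' t - deriv \<psi> t) + l t * (\<phi> t - \<psi> t)\<bar>"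
        by (simp add: algebra_simps)
      also have "\<dots> \<le> \<bar>k t\<bar> * \<bar>\<phi>' t - deriv \<psi> t\<bar> + \<bar>l t\<bar> * \<bar>\<phi> t - \<psi> t\<bar>"
        by (metis abs_mult abs_triangle_ineq)
      also have "\<dots> \<le> \<bar>k t\<bar> * e + \<bar>l t\<bar> * e"
        using \<psi>(2)[OF t] \<psi>(3)[of t] by (intro add_mono mult_left_mono) auto
      finally show "\<bar>(k t * \<phi>' t + l t * \<phi> t) - (k t * deriv \<psi> t + l t * \<psi> t)\<bar> \<le> e * (\<bar>k t\<bar> + \<bar>l t\<bar>)"
        by (simp add: algebra_simps)
    qed
    also have "\<dots> = e * I"
      by (simp add: I_def)
    finally show ?thesis .
  qed
  have "I \<ge> 0"
    unfolding I_def set_lebesgue_integral_def by (rule Bochner_Integration.integral_nonneg) simp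
  have "\<bar>LINT t:{0..2*pi}|lborel. k t * \<phi>' t + l t * \<phi> t\<bar> \<le> 0"
  proof (rule field_le_epsilon)
    fix e :: real assume "0 < e"
    \<comment> \<open>The denominator is \<open>I + 1\<close> because \<open>I\<close> may be
      zero.\<close>
    with bound[of "e / (I + 1)"] \<open>I \<ge> 0\<close>
    have "\<bar>LINT t:{0..2*pi}|lborel. k t * \<phi>' t + l t * \<phi> t\<bar> \<le> e / (I + 1) * I"
      by auto
    also have "\<dots> \<le> e"
      using \<open>0 < e\<close> \<open>I \<ge> 0\<close> by (simp add: field_simps)
    finally show "\<bar>LINT t:{0..2*pi}|lborel. k t * \<phi>' t + l t * \<phi> t\<bar> \<le> 0 + e" by simp
  qed
  then show ?thesis by simp
qed

subsection \<open>Polar coordinates\<close>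

lemma vector_pair_measurable [measurable]: "(\<lambda>p. vector [fst p, snd p] :: real^2) \<in> borel_measurable borel"
  by (intro borel_measurable_continuous_onI linear_continuous_on linear_conv_bounded_linear[THEN iffD1] linearI)
       (auto simp: vec_eq_iff forall_2)

text \<open>Bridges two models of the plane: the change of variables formula lives on vectors,
  Fubini's theorem on pairs.\<close>

lemma lborel_real2: "distr (lborel :: (real \<times> real) measure) borel (\<lambda>p. vector [fst p, snd p] :: real^2) = lborel"
proof (rule lborel_eqI[symmetric])
  fix l u :: "real^2" assume le: "\<And>b. b \<in> Basis \<Longrightarrow> l \<bullet> b \<le> u \<bullet> b"
  have vimage: "(\<lambda>p. vector [fst p, snd p] :: real^2) -` box l u = box (l$1, l$2) (u$1, u$2)"
    by (auto simp: mem_box_cart forall_2) (auto simp: box_def Basis_prod_def)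
  have "l $ i \<le> u $ i" for i
    using le[of "axis i 1"] by (simp add: inner_axis axis_in_Basis_iff)
  then have "emeasure lborel (box (l$1, l$2) (u$1, u$2)) = ennreal ((u$1 - l$1) * (u$2 - l$2))"
    by (subst emeasure_lborel_box) (auto simp: Basis_prod_def prod.union_disjoint)
  moreover have "(\<Prod>b\<in>Basis. (u - l) \<bullet> b) = (u$1 - l$1) * (u$2 - l$2)"
  proof -
    have B: "(Basis :: (real^2) set) = {axis 1 1, axis 2 1}"
      unfolding Basis_vec_def by (auto simp: UNIV_2)
    have "(axis 1 1 :: real^2) \<noteq> axis 2 1"
      by (simp add: axis_eq_axis)
    then show ?thesis
      unfolding B by (simp add: inner_axis)
  qed
  ultimately show "emeasure (distr lborel borel (\<lambda>p. vector [fst p, snd p] :: real^2)) (box l u) = (\<Prod>b\<in>Basis. (u - l) \<bullet> b)"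
    by (simp add: emeasure_distr vimage)
qed simp

lemma norm_e_R [simp]: "norm (e_R \<theta>) = 1"
  by (simp add: e_R_def norm_vec_def L2_set_def sum_2)

lemma e_R_nth [simp]: "e_R \<theta> $ 1 = cos \<theta>" "e_R \<theta> $ 2 = sin \<theta>"
  by (auto simp: e_R_def)

lemma e_\<theta>_nth [simp]: "e_\<theta> \<theta> $ 1 = - sin \<theta>" "e_\<theta> \<theta> $ 2 = cos \<theta>"
  by (auto simp: e_\<theta>_def)

lemma Arg2pi_polar:
  assumes "0 < R" "\<theta> \<in> {0..<2*pi}"
  shows "Arg2pi (Complex ((R *\<^sub>R e_R \<theta>) $ 1) ((R *\<^sub>R e_R \<theta>) $ 2)) = \<theta>"
proof (rule Arg2pi_unique)
  show "of_real R * exp (\<i> * of_real \<theta>) = Complex ((R *\<^sub>R e_R \<theta>) $ 1) ((R *\<^sub>R e_R \<theta>) $ 2)"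
    by (simp add: complex_eq_iff Re_exp Im_exp)
qed (use assms in auto)

lemma polar_decomposition:
  fixes x :: "real^2"
  obtains \<theta> where "\<theta> \<in> {0..<2*pi}" "x = norm x *\<^sub>R e_R \<theta>"
proof
  let ?z = "Complex (x $ 1) (x $ 2)"
  have n: "cmod ?z = norm x"
    by (simp add: norm_vec_def L2_set_def sum_2 cmod_def)
  show "Arg2pi ?z \<in> {0..<2*pi}"
    using Arg2pi[of ?z] by auto
  show "x = norm x *\<^sub>R e_R (Arg2pi ?z)"
    using cos_Arg2pi[of ?z] sin_Arg2pi[of ?z] by (simp add: n vec_eq_iff forall_2)
qed

abbreviation (input) polar_rect :: "real \<Rightarrow> real \<Rightarrow> (real \<times> real) set" where
  "polar_rect R0 R1 \<equiv> {R0<..<R1} \<times> {0..2*pi}"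

lemma polar_inj:
  assumes "0 < R" "0 < R'" "\<theta> \<in> {0..<2*pi}" "\<theta>' \<in> {0..<2*pi}" "R *\<^sub>R e_R \<theta> = R' *\<^sub>R e_R \<theta>'"
  shows "R = R' \<and> \<theta> = \<theta>'"
proof
  from assms(5) have "norm (R *\<^sub>R e_R \<theta>) = norm (R' *\<^sub>R e_R \<theta>')" by simp
  then show R: "R = R'" using assms(1,2) by simp
  show "\<theta> = \<theta>'" using Arg2pi_polar assms by metis
qed

lemma e_R_has_vector_derivative: "(e_R has_vector_derivative e_\<theta> \<theta>) (at \<theta>)"
  unfolding has_vector_derivative_def
  by (rule has_derivative_componentwise_within[THEN iffD2])
     (auto simp: Basis_vec_def inner_axis UNIV_2 e_R_def e_\<theta>_def intro!: derivative_eq_intros)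

lemma e_\<theta>_has_vector_derivative: "(e_\<theta> has_vector_derivative - e_R \<theta>) (at \<theta>)"
  unfolding has_vector_derivative_def
  by (rule has_derivative_componentwise_within[THEN iffD2])
     (auto simp: Basis_vec_def inner_axis UNIV_2 e_R_def e_\<theta>_def intro!: derivative_eq_intros)

lemma continuous_on_e [continuous_intros]:
  assumes "continuous_on S f"
  shows "continuous_on S (\<lambda>x. e_R (f x))" "continuous_on S (\<lambda>x. e_\<theta> (f x))"
proof -
  have "continuous_on UNIV e_R" "continuous_on UNIV e_\<theta>"
    using e_R_has_vector_derivative e_\<theta>_has_vector_derivative
    by (meson continuous_at_imp_continuous_on has_vector_derivative_continuous)+
  then show "continuous_on S (\<lambda>x. e_R (f x))" "continuous_on S (\<lambda>x. e_\<theta> (f x))"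
    using assms by (auto intro: continuous_on_compose2)
qed

section \<open>Lebesgue measure and integrals in polar coordinates\<close>

lemma AE_snd_lborel:
  assumes "AE y in lborel. Q y"
  shows "AE p in (lborel :: (real \<times> real) measure). Q (snd p)"
proof -
  from assms obtain N where N: "{y. \<not> Q y} \<subseteq> N" "N \<in> sets borel" "emeasure lborel N = 0"
    by (auto elim!: AE_E)
  have "emeasure (lborel \<Otimes>\<^sub>M lborel) (UNIV \<times> N) = emeasure lborel (UNIV::real set) * emeasure lborel N"
    using N(2) lborel.emeasure_pair_measure_Times[of UNIV lborel N] by simp
  then have "UNIV \<times> N \<in> null_sets (lborel :: (real \<times> real) measure)"
    using N by (intro null_setsI) (simp_all add: lborel_prod borel_Times)
  then show ?thesis
    by (rule AE_I') (use N(1) in auto)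
qed

text \<open>This is the change of variables formula for images of sets, with Jacobian determinant
  \<open>R\<close>. The map is injective only for half-open angles, hence the auxiliary domain
  \<open>D\<close>; the closed rectangle differs from it by the null line where the angle is
  \<open>2 * pi\<close>.\<close>

lemma emeasure_polar:
  assumes R0: "0 < R0" and A: "A \<in> sets borel" "A \<subseteq> annulus R0 R1"
  shows "emeasure lborel A = (\<integral>\<^sup>+p\<in>polar_rect R0 R1. ennreal (fst p) * indicator A (fst p *\<^sub>R e_R (snd p)) \<partial>lborel)"
proof -
  define D where "D = {x::real^2. x $ 1 \<in> {R0<..<R1} \<and> x $ 2 \<in> {0..<2*pi}}"
  define P where "P x = x $ 1 *\<^sub>R e_R (x $ 2)" for x :: "real^2"
  define P' where "P' x h = (h $ 1) *\<^sub>R e_R (x $ 2) + (x $ 1 * h $ 2) *\<^sub>R e_\<theta> (x $ 2)" for x h :: "real^2"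
  have [measurable]: "D \<in> sets borel"
    unfolding D_def by measurable
  have Pm [measurable]: "P \<in> borel_measurable borel"
    unfolding P_def by (intro borel_measurable_continuous_onI continuous_intros)
  have Dleb: "D \<in> sets lebesgue" by simp
  have img: "P ` D = annulus R0 R1"
  proof (intro set_eqI iffI)
    fix x assume "x \<in> P ` D" then show "x \<in> annulus R0 R1"
      using R0 by (auto simp: P_def D_def annulus_def)
  next
    fix x assume x: "x \<in> annulus R0 R1"
    obtain \<theta> where "\<theta> \<in> {0..<2*pi}" "x = norm x *\<^sub>R e_R \<theta>" by (rule polar_decomposition)
    then have "x = P (vector [norm x, \<theta>])" "vector [norm x, \<theta>] \<in> D"
      using x by (auto simp: P_def D_def annulus_def)
    then show "x \<in> P ` D" by blast
  qed
  have der: "(P has_derivative P' x) (at x within D)" for x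
    unfolding P_def P'_def
proof -
    have 1: "((\<lambda>x. x $ i) has_derivative (\<lambda>h. h $ i)) (at x within D)" for i
      by (rule bounded_linear_imp_has_derivative) (rule bounded_linear_vec_nth)
    have 2: "((\<lambda>x. e_R (x $ 2)) has_derivative (\<lambda>h. (h $ 2) *\<^sub>R e_\<theta> (x $ 2))) (at x within D)"
      using has_derivative_compose[OF 1, of e_R] e_R_has_vector_derivative[of "x $ 2"]
      by (simp add: has_vector_derivative_def)
    show "((\<lambda>x. x $ 1 *\<^sub>R e_R (x $ 2)) has_derivative
        (\<lambda>h. (h $ 1) *\<^sub>R e_R (x $ 2) + (x $ 1 * h $ 2) *\<^sub>R e_\<theta> (x $ 2))) (at x within D)"
      using has_derivative_scaleR[OF 1 2] by (simp add: add.commute)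
  qed
  have inj: "inj_on P D"
  proof (rule inj_onI)
    fix x y assume "x \<in> D" "y \<in> D" "P x = P y"
    then have "x $ 1 = y $ 1 \<and> x $ 2 = y $ 2"
      using R0 by (intro polar_inj) (auto simp: P_def D_def)
    then show "x = y" by (simp add: vec_eq_iff forall_2)
  qed
  have det: "\<bar>det (matrix (P' x))\<bar> = x $ 1" if "x \<in> D" for x
  proof -
    have "det (matrix (P' x)) = x $ 1 * (cos (x $ 2) * cos (x $ 2)) + x $ 1 * (sin (x $ 2) * sin (x $ 2))"
      unfolding det_2 matrix_def P'_def by (simp add: axis_def mult_ac)
    also have "\<dots> = x $ 1"
      by (simp flip: distrib_left)
    finally have "det (matrix (P' x)) = x $ 1" .
    with that R0 show ?thesis by (simp add: D_def)
  qed
  have A': "P ` (D \<inter> P -` A) = A"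
  proof -
    have "P ` (D \<inter> P -` A) = P ` D \<inter> A" by blast
    with img A(2) show ?thesis by (simp add: Int_absorb1)
  qed
  have [measurable]: "D \<inter> P -` A \<in> sets borel"
    using measurable_sets[OF Pm A(1)] by simp
  \<comment> \<open>The formula speaks of real-valued \<open>measure\<close>, so the measure of
    \<open>A\<close> has to be finite before returning to \<open>emeasure\<close>.\<close>
  have "bounded A"
    using A(2) by (auto simp: bounded_iff annulus_def intro!: exI[of _ R1])
  then have fin: "emeasure lborel A < \<infinity>"
    using emeasure_bounded_finite by auto
  then have "A \<in> lmeasurable"
    using A(1) by (auto simp: fmeasurable_def)
  then have "((\<lambda>x. \<bar>det (matrix (P' x))\<bar>) has_integral measure lebesgue A) (D \<inter> P -` A)"
    using has_measure_differentiable_image[of "D \<inter> P -` A" P P' "measure lebesgue A"]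
      has_derivative_subset[OF der, of "D \<inter> P -` A"] inj A'
    by (auto intro: inj_on_subset)
  then have "((\<lambda>x. x $ 1) has_integral measure lborel A) (D \<inter> P -` A)"
    using A(1) det by (subst has_integral_cong[where g = "\<lambda>x. \<bar>det (matrix (P' x))\<bar>"]) auto
  then have "(\<integral>\<^sup>+x. indicator (D \<inter> P -` A) x * ennreal (x $ 1) \<partial>lborel) = ennreal (measure lborel A)"
  proof -
    assume "((\<lambda>x. x $ 1) has_integral measure lborel A) (D \<inter> P -` A)"
    with R0 have "integral\<^sup>N lborel (\<lambda>x. indicator (D \<inter> P -` A) x * x $ 1) = measure lborel A"
      by (intro nn_integral_has_integral_lebesgue) (auto simp: D_def)
    moreover have "indicator (D \<inter> P -` A) x * ennreal (x $ 1) = ennreal (indicator (D \<inter> P -` A) x * x $ 1)" for x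
      by (simp add: indicator_def)
    ultimately show ?thesis by simp
  qed
  also have "\<dots> = emeasure lborel A"
    using fin by (simp add: emeasure_eq_ennreal_measure)
  also have "(\<integral>\<^sup>+x. indicator (D \<inter> P -` A) x * ennreal (x $ 1) \<partial>lborel)
     = (\<integral>\<^sup>+p. indicator (D \<inter> P -` A) (vector [fst p, snd p] :: real^2) * ennreal (fst p) \<partial>lborel)"
    by (subst lborel_real2[symmetric], subst nn_integral_distr) auto
  also have "\<dots> = (\<integral>\<^sup>+p\<in>polar_rect R0 R1. ennreal (fst p) * indicator A (fst p *\<^sub>R e_R (snd p)) \<partial>lborel)"
    using AE_snd_lborel[OF AE_lborel_singleton[of "2 * pi"]]
    by (intro nn_integral_cong_AE, eventually_elim) (auto simp: D_def P_def indicator_def)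
  finally show ?thesis by simp
qed

lemma polar_map_measurable [measurable]: "(\<lambda>p. fst p *\<^sub>R e_R (snd p)) \<in> borel_measurable borel"
  by (intro borel_measurable_continuous_onI continuous_intros)

lemma annulus_measurable [measurable]: "annulus R0 R1 \<in> sets borel"
  unfolding annulus_def by measurable

lemma polar_rect_measurable [measurable]: "polar_rect R0 R1 \<in> sets borel"
  by (simp add: borel_Times)

lemma polar_weight_measurable [measurable]:
  "(\<lambda>p. indicator (polar_rect R0 R1) p * fst p) \<in> borel_measurable borel"
  by (intro borel_measurable_times borel_measurable_indicator polar_rect_measurable
      borel_measurable_continuous_onI continuous_intros)

text \<open>Stating the change of variables as an identity of measures lets the generic rules for
  densities and push-forwards yield the nonnegative and the Bochner version alike.\<close>

lemma distr_polar:
  assumes R0: "0 < R0"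
  shows "distr (density lborel (\<lambda>p. ennreal (indicator (polar_rect R0 R1) p * fst p))) borel
      (\<lambda>p. fst p *\<^sub>R e_R (snd p)) = density lborel (\<lambda>x. ennreal (indicator (annulus R0 R1) x))"
    (is "distr (density lborel ?w) borel ?P = ?R")
proof (rule measure_eqI)
  fix A assume "A \<in> sets (distr (density lborel ?w) borel ?P)"
  then have A [measurable]: "A \<in> sets borel" by simp
  have "emeasure (distr (density lborel ?w) borel ?P) A = (\<integral>\<^sup>+p. ?w p * indicator (?P -` A) p \<partial>lborel)"
    using measurable_sets[OF polar_map_measurable A]
    by (simp add: emeasure_distr emeasure_density)
  also have "\<dots> = (\<integral>\<^sup>+p\<in>polar_rect R0 R1. ennreal (fst p) * indicator (A \<inter> annulus R0 R1) (?P p) \<partial>lborel)"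
    using R0 by (intro nn_integral_cong) (auto simp: indicator_def annulus_def)
  also have "\<dots> = emeasure lborel (A \<inter> annulus R0 R1)"
    by (rule emeasure_polar[symmetric]) (use R0 in auto)
  also have "\<dots> = emeasure ?R A"
    by (subst emeasure_density)
       (auto simp: ennreal_indicator indicator_inter_arith mult.commute simp flip: nn_integral_indicator)
  finally show "emeasure (distr (density lborel ?w) borel ?P) A = emeasure ?R A" .
qed simp

lemma nn_integral_polar:
  assumes R0: "0 < R0" and f [measurable]: "f \<in> borel_measurable borel"
  shows "(\<integral>\<^sup>+x\<in>annulus R0 R1. f x \<partial>lborel)
    = (\<integral>\<^sup>+p\<in>polar_rect R0 R1. ennreal (fst p) * f (fst p *\<^sub>R e_R (snd p)) \<partial>lborel)"
proof -
  let ?P = "\<lambda>p. fst p *\<^sub>R e_R (snd p)" and ?w = "\<lambda>p. ennreal (indicator (polar_rect R0 R1) p * fst p)"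
  have "(\<integral>\<^sup>+x\<in>annulus R0 R1. f x \<partial>lborel) = integral\<^sup>N (density lborel (\<lambda>x. ennreal (indicator (annulus R0 R1) x))) f"
    by (subst nn_integral_density) (auto simp: ennreal_indicator mult.commute)
  also have "\<dots> = (\<integral>\<^sup>+p. ?w p * f (?P p) \<partial>lborel)"
    unfolding distr_polar[OF R0, symmetric]
    by (subst nn_integral_distr) (auto simp: nn_integral_density)
  also have "\<dots> = (\<integral>\<^sup>+p\<in>polar_rect R0 R1. ennreal (fst p) * f (?P p) \<partial>lborel)"
    by (intro nn_integral_cong) (auto simp: indicator_def)
  finally show ?thesis .
qed

lemma
  fixes f :: "real^2 \<Rightarrow> 'b::{banach, second_countable_topology}"
  assumes R0: "0 < R0" and f [measurable]: "f \<in> borel_measurable borel"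
  shows set_integrable_polar: "set_integrable lborel (annulus R0 R1) f \<longleftrightarrow>
      set_integrable lborel (polar_rect R0 R1) (\<lambda>p. fst p *\<^sub>R f (fst p *\<^sub>R e_R (snd p)))"
    and set_integral_polar: "(LINT x:annulus R0 R1|lborel. f x)
      = (LINT p:polar_rect R0 R1|lborel. fst p *\<^sub>R f (fst p *\<^sub>R e_R (snd p)))"
proof -
  let ?P = "\<lambda>p. fst p *\<^sub>R e_R (snd p)" and ?w = "\<lambda>p. indicator (polar_rect R0 R1) p * fst p"
  have w: "AE p in lborel. 0 \<le> ?w p"
    using R0 by (auto simp: indicator_def)
  have eq: "indicator (polar_rect R0 R1) p *\<^sub>R fst p *\<^sub>R f (?P p) = ?w p *\<^sub>R f (?P p)" for p
    by simp
  show "set_integrable lborel (annulus R0 R1) f \<longleftrightarrow>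
      set_integrable lborel (polar_rect R0 R1) (\<lambda>p. fst p *\<^sub>R f (?P p))"
    unfolding set_integrable_def eq
    using integrable_density[of f lborel "indicator (annulus R0 R1)"]
      integrable_density[of "\<lambda>p. f (?P p)" lborel ?w]
      integrable_distr_eq[of ?P "density lborel ?w" borel f] w
    by (simp add: distr_polar[OF R0])
  show "(LINT x:annulus R0 R1|lborel. f x) = (LINT p:polar_rect R0 R1|lborel. fst p *\<^sub>R f (?P p))"
    unfolding set_lebesgue_integral_def eq
    using integral_density[of f lborel "indicator (annulus R0 R1)"]
      integral_density[of "\<lambda>p. f (?P p)" lborel ?w]
      integral_distr[of ?P "density lborel ?w" borel f] w
    by (simp add: distr_polar[OF R0])
qed

section \<open>Products of continuous functions with integrable angular coefficients\<close>

text \<open>Continuity up to the closed rectangle makes \<open>c\<close> bounded, so the product is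
  dominated by a constant times \<open>\<bar>k\<bar>\<close> on a bounded radial interval, which is
  integrable by Fubini's theorem.\<close>

lemma set_integrable_polar_rect:
  fixes c :: "real \<times> real \<Rightarrow> real" and k :: "real \<Rightarrow> real"
  assumes k: "set_integrable lborel {0..2*pi} k" and c: "continuous_on ({R0..R1} \<times> {0..2*pi}) c"
  shows "set_integrable lborel (polar_rect R0 R1) (\<lambda>p. c p * k (snd p))"
proof -
  define k0 where "k0 = (\<lambda>t. indicator {0..2*pi} t *\<^sub>R k t)"
  have k0: "integrable lborel k0"
    using k by (simp add: set_integrable_def k0_def)
  then have [measurable]: "k0 \<in> borel_measurable borel"
    by (auto dest: borel_measurable_integrable)
  define c0 where "c0 = (\<lambda>p. indicator ({R0..R1} \<times> {0..2*pi}) p *\<^sub>R c p)"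
  have "c0 \<in> borel_measurable borel"
    unfolding c0_def by (rule borel_measurable_continuous_on_indicator[OF _ c]) (simp add: borel_Times)
  then have [measurable]: "c0 \<in> borel_measurable (lborel \<Otimes>\<^sub>M lborel)"
    by (simp add: lborel_prod)
  have "compact (c ` ({R0..R1} \<times> {0..2*pi}))"
    by (intro compact_continuous_image c compact_Times) auto
  then obtain B where B: "\<forall>p\<in>{R0..R1} \<times> {0..2*pi}. norm (c p) \<le> B"
    by (meson bounded_iff compact_imp_bounded imageI)
  define b where "b p = (B * indicator {R0..R1} (fst p)) * k0 (snd p)" for p :: "real \<times> real"
  have "integrable (lborel \<Otimes>\<^sub>M lborel) b"
  proof (rule lborel_pair.Fubini_integrable)
    show "b \<in> borel_measurable (lborel \<Otimes>\<^sub>M lborel)"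
      unfolding b_def by measurable
    have "integrable lborel (\<lambda>x. \<bar>B\<bar> * indicator {R0..R1} x * (\<integral>y. norm (k0 y) \<partial>lborel))"
      by (intro integrable_mult_left integrable_mult_right integrable_real_indicator)
         (auto simp: emeasure_lborel_Icc_eq)
    then show "integrable lborel (\<lambda>x. \<integral>y. norm (b (x, y)) \<partial>lborel)"
      by (simp add: b_def abs_mult)
    show "AE x in lborel. integrable lborel (\<lambda>y. b (x, y))"
      unfolding b_def using k0 by simp
  qed
  then have "integrable (lborel \<Otimes>\<^sub>M lborel)
      (\<lambda>p. indicator (polar_rect R0 R1) p *\<^sub>R (c p * k (snd p)))"
  proof (rule Bochner_Integration.integrable_bound)
    have eq: "indicator (polar_rect R0 R1) p *\<^sub>R (c p * k (snd p)) = indicator {R0<..<R1} (fst p) * c0 p * k0 (snd p)" for p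
      by (auto simp: indicator_def c0_def k0_def)
    show "(\<lambda>p. indicator (polar_rect R0 R1) p *\<^sub>R (c p * k (snd p))) \<in> borel_measurable (lborel \<Otimes>\<^sub>M lborel)"
      unfolding eq by measurable
    have "norm (indicator (polar_rect R0 R1) p *\<^sub>R (c p * k (snd p))) \<le> norm (b p)" for p
    proof (cases "p \<in> polar_rect R0 R1")
      case True
      then have "\<bar>c p\<bar> \<le> B"
        using bspec[OF B, of p] True by (auto simp: mem_Times_iff)
      then have "\<bar>c p\<bar> \<le> \<bar>B\<bar>" by linarith
      then show ?thesis
        using True mult_right_mono[of "\<bar>c p\<bar>" "\<bar>B\<bar>" "\<bar>k (snd p)\<bar>"]
        by (auto simp: b_def k0_def abs_mult)
    qed simp
    then show "AE p in lborel \<Otimes>\<^sub>M lborel. norm (indicator (polar_rect R0 R1) p *\<^sub>R (c p * k (snd p))) \<le> norm (b p)"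
      by simp
  qed
  then show ?thesis
    by (simp add: set_integrable_def lborel_prod)
qed

text \<open>Fubini's theorem with the radial integral inside: there \<open>k\<close> is a constant
  and the fundamental theorem of calculus leaves only boundary values. In the applications these
  vanish by compact support of the test field.\<close>

lemma set_integral_polar_rect_radial_derivative:
  fixes c :: "real \<times> real \<Rightarrow> real" and k :: "real \<Rightarrow> real"
  assumes k: "set_integrable lborel {0..2*pi} k" and c: "continuous_on ({R0..R1} \<times> {0..2*pi}) c"
    and R: "R0 \<le> R1"
    and deriv: "\<And>R \<theta>. R \<in> {R0..R1} \<Longrightarrow> ((\<lambda>r. \<psi> r \<theta>) has_real_derivative c (R, \<theta>)) (at R)"
    and boundary: "\<And>\<theta>. \<psi> R0 \<theta> = \<psi> R1 \<theta>"
  shows "(LINT p:polar_rect R0 R1|lborel. c p * k (snd p)) = 0"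
proof -
  let ?f = "\<lambda>R \<theta>. indicator (polar_rect R0 R1) (R, \<theta>) *\<^sub>R (c (R, \<theta>) * k \<theta>)"
  have inner: "(\<integral>R. ?f R \<theta> \<partial>lborel) = 0" for \<theta>
  proof (cases "\<theta> \<in> {0..2*pi}")
    case True
    have "continuous_on {R0..R1} (\<lambda>R. c (R, \<theta>))"
      using True by (intro continuous_on_compose2[OF c]) (auto intro!: continuous_intros)
    then have "(\<integral>R. indicator {R0..R1} R *\<^sub>R c (R, \<theta>) \<partial>lborel) = \<psi> R1 \<theta> - \<psi> R0 \<theta>"
      using deriv R by (intro integral_FTC_Icc)
        (auto simp: has_real_derivative_iff_has_vector_derivative intro: has_vector_derivative_at_within)
    then have "(\<integral>R. (indicator {R0..R1} R *\<^sub>R c (R, \<theta>)) * k \<theta> \<partial>lborel) = 0"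
      by (simp add: boundary)
    also have "(\<integral>R. (indicator {R0..R1} R *\<^sub>R c (R, \<theta>)) * k \<theta> \<partial>lborel) = (\<integral>R. ?f R \<theta> \<partial>lborel)"
    proof (rule integral_cong_AE)
      have [measurable]: "(\<lambda>R. indicator {R0..R1} R *\<^sub>R c (R, \<theta>)) \<in> borel_measurable borel"
        by (intro borel_measurable_continuous_on_indicator) (auto intro!: \<open>continuous_on {R0..R1} (\<lambda>R. c (R, \<theta>))\<close>)
      show "(\<lambda>R. (indicator {R0..R1} R *\<^sub>R c (R, \<theta>)) * k \<theta>) \<in> borel_measurable lborel"
        by measurable
      have "?f R \<theta> = indicator {R0<..<R1} R * ((indicator {R0..R1} R *\<^sub>R c (R, \<theta>)) * k \<theta>)" for R
        using True by (auto simp: indicator_def)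
      then have "(\<lambda>R. ?f R \<theta>) = (\<lambda>R. indicator {R0<..<R1} R * ((indicator {R0..R1} R *\<^sub>R c (R, \<theta>)) * k \<theta>))"
        by (rule ext)
      then show "(\<lambda>R. ?f R \<theta>) \<in> borel_measurable lborel"
        by (simp only:) measurable
      have "AE R in lborel. R \<noteq> R0 \<and> R \<noteq> R1"
        using AE_lborel_singleton[of R0] AE_lborel_singleton[of R1] by eventually_elim auto
      then show "AE R in lborel. (indicator {R0..R1} R *\<^sub>R c (R, \<theta>)) * k \<theta> = ?f R \<theta>"
        by eventually_elim (use True in \<open>auto simp: indicator_def\<close>)
    qed
    finally show ?thesis .
  next
    case False
    then have "?f R \<theta> = 0" for R by (simp add: indicator_def)
    then show ?thesis by (simp only: Bochner_Integration.integral_zero)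
  qed
  have "integrable (lborel \<Otimes>\<^sub>M lborel) (\<lambda>(R, \<theta>). ?f R \<theta>)"
    using set_integrable_polar_rect[OF k c] by (simp add: set_integrable_def lborel_prod case_prod_unfold)
  from lborel_pair.integral_snd[OF this, unfolded inner] show ?thesis
    by (simp add: set_lebesgue_integral_def lborel_prod case_prod_unfold)
qed

text \<open>Fubini's theorem with the angular integral inside: for each fixed radius, \<psi> is an
  admissible C^1 test function on the circle. The coefficients \<open>k\<close> and \<open>l\<close>
  are never differentiated.\<close>

lemma
  fixes \<psi> \<psi>' :: "real \<times> real \<Rightarrow> real" and k l :: "real \<Rightarrow> real"
  assumes k: "set_integrable lborel {0..2*pi} k" and l: "set_integrable lborel {0..2*pi} l"
    and weak: "\<And>\<phi>. smooth_circle \<phi> \<Longrightarrow> (LINT t:{0..2*pi}|lborel. k t * deriv \<phi> t + l t * \<phi> t) = 0"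
    and \<psi>: "continuous_on ({R0..R1} \<times> UNIV) \<psi>" and \<psi>': "continuous_on ({R0..R1} \<times> UNIV) \<psi>'"
    and deriv: "\<And>R \<theta>. R \<in> {R0..R1} \<Longrightarrow> ((\<lambda>t. \<psi> (R, t)) has_real_derivative \<psi>' (R, \<theta>)) (at \<theta>)"
    and per: "\<And>R \<theta>. \<psi> (R, \<theta> + 2 * pi) = \<psi> (R, \<theta>)"
  shows set_integrable_polar_rect_weak:
      "set_integrable lborel (polar_rect R0 R1) (\<lambda>p. \<psi>' p * k (snd p) + \<psi> p * l (snd p))"
    and set_integral_polar_rect_weak:
      "(LINT p:polar_rect R0 R1|lborel. \<psi>' p * k (snd p) + \<psi> p * l (snd p)) = 0"
proof -
  show int: "set_integrable lborel (polar_rect R0 R1) (\<lambda>p. \<psi>' p * k (snd p) + \<psi> p * l (snd p))"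
    by (intro set_integral_add set_integrable_polar_rect k l)
       (auto intro: continuous_on_subset[OF \<psi>] continuous_on_subset[OF \<psi>'])
  let ?f = "\<lambda>R \<theta>. indicator (polar_rect R0 R1) (R, \<theta>) *\<^sub>R (\<psi>' (R, \<theta>) * k \<theta> + \<psi> (R, \<theta>) * l \<theta>)"
  have inner: "(\<integral>\<theta>. ?f R \<theta> \<partial>lborel) = 0" for R
  proof (cases "R \<in> {R0<..<R1}")
    case True
    have "continuous_on UNIV (\<lambda>\<theta>. \<psi>' (R, \<theta>))"
      using True by (intro continuous_on_compose2[OF \<psi>']) (auto intro!: continuous_intros)
    then have "(LINT t:{0..2*pi}|lborel. k t * \<psi>' (R, t) + l t * \<psi> (R, t)) = 0"
      using True by (intro weak_equation_C1_circle[OF k l weak]) (simp_all add: deriv per)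
    moreover have "?f R \<theta> = indicator {0..2*pi} \<theta> *\<^sub>R (k \<theta> * \<psi>' (R, \<theta>) + l \<theta> * \<psi> (R, \<theta>))" for \<theta>
      using True by (auto simp: indicator_def)
    ultimately show ?thesis
      by (simp add: set_lebesgue_integral_def)
  next
    case False
    then have "?f R \<theta> = 0" for \<theta> by (auto simp: indicator_def)
    then show ?thesis by (simp only: Bochner_Integration.integral_zero)
  qed
  have "integrable (lborel \<Otimes>\<^sub>M lborel) (\<lambda>(R, \<theta>). ?f R \<theta>)"
    using int by (simp add: set_integrable_def lborel_prod case_prod_unfold)
  from lborel_pair.integral_fst[OF this, unfolded inner]
  show "(LINT p:polar_rect R0 R1|lborel. \<psi>' p * k (snd p) + \<psi> p * l (snd p)) = 0"
    by (simp add: set_lebesgue_integral_def lborel_prod case_prod_unfold)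
qed

subsection \<open>The stored energy and the tensor \<open>M\<close>\<close>

lemma admissible_h_top: "admissible_h h \<Longrightarrow> t \<le> 0 \<Longrightarrow> h t = \<infinity>"
  by (simp add: admissible_h_def)

lemma admissible_h_real: "admissible_h h \<Longrightarrow> 0 < t \<Longrightarrow> h t = ennreal (real_val h t)"
  by (simp add: admissible_h_def real_val_def less_top)

lemma admissible_h_has_derivative:
  "admissible_h h \<Longrightarrow> 0 < t \<Longrightarrow> (real_val h has_real_derivative deriv (real_val h) t) (at t)"
  by (simp add: admissible_h_def DERIV_deriv_iff_real_differentiable)

lemma real_val_nonneg: "0 \<le> real_val f x"
  by (simp add: real_val_def)

lemma borel_measurable_admissible_h:
  assumes h: "admissible_h h"
  shows "h \<in> borel_measurable borel"
proof -
  have "continuous_on {0<..} (real_val h)"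
    using admissible_h_has_derivative[OF h] by (intro DERIV_continuous_on[where D = "deriv (real_val h)"])
      (auto intro: has_field_derivative_at_within)
  then have [measurable]: "(\<lambda>t. indicator {0<..} t *\<^sub>R real_val h t) \<in> borel_measurable borel"
    by (intro borel_measurable_continuous_on_indicator) auto
  have "h = (\<lambda>t. if t \<in> {0<..} then ennreal (indicator {0<..} t *\<^sub>R real_val h t) else \<infinity>)"
    using admissible_h_top[OF h] admissible_h_real[OF h] by (auto simp: fun_eq_iff)
  also have "\<dots> \<in> borel_measurable borel"
    by measurable
  finally show ?thesis .
qed

lemma continuous_on_det: "continuous_on S (det :: real^2^2 \<Rightarrow> real)"
  unfolding det_2 by (intro continuous_intros)

lemma borel_measurable_det [measurable]: "(det :: real^2^2 \<Rightarrow> real) \<in> borel_measurable borel"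
  by (intro borel_measurable_continuous_onI continuous_on_det)

lemma borel_measurable_W:
  assumes h: "admissible_h h"
  shows "W h \<in> borel_measurable borel"
proof -
  note [measurable] = borel_measurable_admissible_h[OF h]
  show ?thesis unfolding W_def by measurable
qed

lemma W_finite_iff:
  assumes h: "admissible_h h"
  shows "W h F < \<infinity> \<longleftrightarrow> 0 < det F"
  using admissible_h_top[OF h, of "det F"] admissible_h_real[OF h, of "det F"]
  by (cases "0 < det F") (auto simp: W_def)

lemma real_val_W:
  assumes h: "admissible_h h" and "0 < det F"
  shows "real_val (W h) F = (norm F)\<^sup>2 / 2 + real_val h (det F)"
  using admissible_h_real[OF assms] real_val_nonneg[of h "det F"]
  by (simp add: real_val_def[of "W h"] W_def flip: ennreal_plus)

lemma real_val_W_eq_0: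
  assumes h: "admissible_h h" and "det F \<le> 0"
  shows "real_val (W h) F = 0"
  using admissible_h_top[OF assms] by (simp add: real_val_def W_def)

text \<open>The gradient of \<open>det\<close>; for invertible \<open>F\<close> it is the
  determinant times the inverse transpose.\<close>

definition cofactor2 :: "real^2^2 \<Rightarrow> real^2^2" where
  "cofactor2 F = vector [vector [F$2$2, - F$2$1], vector [- F$1$2, F$1$1]]"

lemma cofactor2_nth [simp]:
  "cofactor2 F $ 1 $ 1 = F$2$2" "cofactor2 F $ 1 $ 2 = - F$2$1"
  "cofactor2 F $ 2 $ 1 = - F$1$2" "cofactor2 F $ 2 $ 2 = F$1$1"
  by (auto simp: cofactor2_def)

lemma inner_matrix2: "(A :: real^2^2) \<bullet> B = A$1$1 * B$1$1 + A$1$2 * B$1$2 + A$2$1 * B$2$1 + A$2$2 * B$2$2"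
  by (simp add: inner_vec_def sum_2)

lemma continuous_on_cofactor2 [continuous_intros]:
  "continuous_on S cofactor2"
proof -
  have "bounded_linear cofactor2"
    by (intro linear_conv_bounded_linear[THEN iffD1] linearI) (auto simp: vec_eq_iff forall_2)
  then show ?thesis by (rule linear_continuous_on)
qed

lemma det_has_derivative: "(det has_derivative (\<lambda>H. cofactor2 F \<bullet> H)) (at (F :: real^2^2))"
proof -
  have 1: "((\<lambda>F. F $ i $ j) has_derivative (\<lambda>H. H $ i $ j)) (at F)" for i j and F :: "real^2^2"
    by (rule bounded_linear_imp_has_derivative)
      (intro bounded_linear_compose[OF bounded_linear_vec_nth] bounded_linear_vec_nth)
  show ?thesis
    unfolding det_2
    by (rule has_derivative_eq_rhs, rule has_derivative_diff; (rule has_derivative_mult[OF 1 1])?)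
       (auto simp: inner_matrix2 fun_eq_iff algebra_simps)
qed

lemma det_add_scaled: "det (F + t *\<^sub>R G) = det F + t * (cofactor2 F \<bullet> G) + t\<^sup>2 * det (G :: real^2^2)"
  by (simp add: det_2 inner_matrix2 power2_eq_square algebra_simps)

text \<open>On the open set of positive determinant the real version of \<open>W\<close> agrees with
  a differentiable expression, so the chain rule applies and the extended values elsewhere do not
  interfere.\<close>

lemma DW_formula:
  assumes h: "admissible_h h" and F: "0 < det F"
  shows "DW h F = F + deriv (real_val h) (det F) *\<^sub>R cofactor2 F"
proof -
  have "((\<lambda>F. (F \<bullet> F) / 2 + real_val h (det F)) has_derivative
      (\<lambda>H. F \<bullet> H + deriv (real_val h) (det F) * (cofactor2 F \<bullet> H))) (at F)"
    using has_derivative_compose[OF det_has_derivative, of "real_val h", OF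
        admissible_h_has_derivative[OF h F, unfolded has_field_derivative_def]]
    by (auto intro!: derivative_eq_intros simp: inner_commute)
  moreover have "open {F :: real^2^2. 0 < det F}"
    using continuous_on_det by (intro open_Collect_less continuous_intros) auto
  ultimately have "(real_val (W h) has_derivative
      (\<lambda>H. F \<bullet> H + deriv (real_val h) (det F) * (cofactor2 F \<bullet> H))) (at F)"
    by (rule has_derivative_transform_within_open) (use F in \<open>auto simp: real_val_W[OF h] power2_norm_eq_inner\<close>)
  then have "frechet_derivative (real_val (W h)) (at F) = (\<lambda>H. F \<bullet> H + deriv (real_val h) (det F) * (cofactor2 F \<bullet> H))"
    by (rule frechet_derivative_at[symmetric])
  then show ?thesis
    by (simp add: DW_def vec_eq_iff inner_axis)
qed

text \<open>A default value: \<open>W\<close> is infinite there, \<open>enn2real\<close> sends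
  infinity to 0, and the real version is therefore constant on an open set. It enters the
  measurability of \<open>DW\<close>.\<close>

lemma DW_eq_0:
  assumes h: "admissible_h h" and F: "det F < 0"
  shows "DW h F = 0"
proof -
  have "open {F :: real^2^2. det F < 0}"
    using continuous_on_det by (intro open_Collect_less continuous_intros) auto
  with has_derivative_const have "(real_val (W h) has_derivative (\<lambda>H. 0)) (at F)"
    by (rule has_derivative_transform_within_open) (use F in \<open>auto simp: real_val_W_eq_0[OF h]\<close>)
  then have "frechet_derivative (real_val (W h)) (at F) = (\<lambda>H. 0)"
    by (rule frechet_derivative_at[symmetric])
  then show ?thesis
    by (simp add: DW_def vec_eq_iff)
qed

text \<open>Integrability over \<^const>\<open>lborel\<close> requires Borel measurability, so the values of \<open>DW\<close> on the null
  set where the determinant vanishes matter. There \<open>W\<close> is not differentiable, so that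
  \<^const>\<open>frechet_derivative\<close> is one fixed junk value.\<close>

lemma real_val_W_not_differentiable:
  assumes h: "admissible_h h" and F: "det F = 0"
  shows "\<not> real_val (W h) differentiable (at F)"
proof
  assume "real_val (W h) differentiable (at F)"
  then have cont: "isCont (real_val (W h)) F"
    by (rule differentiable_imp_continuous_within)
  \<comment> \<open>\<open>G\<close> is a direction that leads from the zero set of
    \<open>det\<close> into the region of positive determinant. At \<open>F = 0\<close> the identity
    serves; otherwise the cofactor does, since the linear coefficient in
    \<open>det_add_scaled\<close> becomes its squared norm and its own determinant equals
    \<open>det F = 0\<close>.\<close>
  obtain G :: "real^2^2" where G: "\<And>t. 0 < t \<Longrightarrow> 0 < det (F + t *\<^sub>R G)"
  proof (cases "F = 0")
    case True
    show thesis by (rule that[of "mat 1"]) (simp add: True det_2 mat_def)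
  next
    case False
    then have "0 < cofactor2 F \<bullet> cofactor2 F"
      by (auto simp: vec_eq_iff forall_2 inner_matrix2 add_nonneg_eq_0_iff less_le)
    moreover have "det (cofactor2 F) = 0"
      using F by (simp add: det_2 algebra_simps)
    ultimately show thesis
      by (intro that[of "cofactor2 F"]) (simp add: det_add_scaled F)
  qed
  have lim: "((\<lambda>t. F + t *\<^sub>R G) \<longlongrightarrow> F) (at_right 0)"
    by (rule tendsto_eq_intros refl | simp)+
  have "((\<lambda>t. det (F + t *\<^sub>R G)) \<longlongrightarrow> 0) (at_right 0)"
    using isCont_tendsto_compose[OF _ lim, of det] continuous_on_det[of UNIV] F
    by (simp add: continuous_on_eq_continuous_at)
  then have "filterlim (\<lambda>t. det (F + t *\<^sub>R G)) (at_right 0) (at_right 0)"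
    by (auto simp: filterlim_at G less_imp_neq[OF G, symmetric] intro!: eventually_at_rightI[of 0 1])
  moreover have "(h \<longlongrightarrow> \<infinity>) (at_right 0)"
    using h by (simp add: admissible_h_def)
  ultimately have "((\<lambda>t. h (det (F + t *\<^sub>R G))) \<longlongrightarrow> \<infinity>) (at_right 0)"
    by (rule filterlim_compose[rotated])
  \<comment> \<open>Along this ray \<open>h\<close> blows up, so the real version of
    \<open>W\<close> exceeds its value at \<open>F\<close> by more than 1 arbitrarily close to
    \<open>F\<close>; continuity at \<open>F\<close> forbids this.\<close>
  then have "\<forall>\<^sub>F t in at_right 0. ennreal (real_val (W h) F + 1) < h (det (F + t *\<^sub>R G))"
    by (rule order_tendstoD) simp
  moreover have "\<forall>\<^sub>F t in at_right 0. 0 < det (F + t *\<^sub>R G)"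
    by (auto simp: G intro!: eventually_at_rightI[of 0 1])
  ultimately have "\<forall>\<^sub>F t in at_right 0. real_val (W h) F + 1 < real_val (W h) (F + t *\<^sub>R G)"
  proof eventually_elim
    case (elim t)
    then have "real_val (W h) F + 1 < real_val h (det (F + t *\<^sub>R G))"
      using admissible_h_real[OF h] real_val_nonneg[of "W h" F] by (simp add: ennreal_less_iff del: ennreal_plus)
    also have "\<dots> \<le> real_val (W h) (F + t *\<^sub>R G)"
      using elim by (simp add: real_val_W[OF h])
    finally show ?case .
  qed
  moreover have "\<forall>\<^sub>F t in at_right 0. real_val (W h) (F + t *\<^sub>R G) < real_val (W h) F + 1"
    by (rule order_tendstoD(2)[OF isCont_tendsto_compose[OF cont lim]]) simp
  ultimately have "\<forall>\<^sub>F t in at_right (0::real). False"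
    by eventually_elim simp
  then show False by simp
qed

lemma borel_measurable_DW:
  assumes h: "admissible_h h"
  shows "DW h \<in> borel_measurable borel"
proof -
  \<comment> \<open>Without a derivative, the predicate from which \<open>frechet_derivative\<close>
    chooses is constantly false, so the choice is independent of \<open>F\<close>.\<close>
  define D0 :: "real^2^2" where
    "D0 = (\<chi> i j. (SOME f :: real^2^2 \<Rightarrow> real. False) (axis i (axis j 1)))"
  have zero: "DW h F = D0" if "det F = 0" for F
  proof -
    have "frechet_derivative (real_val (W h)) (at F) = (SOME f. False)"
      using real_val_W_not_differentiable[OF h that]
      by (simp add: frechet_derivative_def differentiable_def)
    then show ?thesis by (simp add: DW_def D0_def)
  qed
  let ?P = "{F :: real^2^2. 0 < det F}"
  have "continuous_on {0<..} (deriv (real_val h))"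
    using h by (auto simp: admissible_h_def intro!: continuous_at_imp_continuous_on differentiable_imp_continuous_within)
  then have "continuous_on ?P (\<lambda>F. deriv (real_val h) (det F))"
    by (rule continuous_on_compose2[OF _ continuous_on_det]) auto
  then have "continuous_on ?P (\<lambda>F. F + deriv (real_val h) (det F) *\<^sub>R cofactor2 F)"
    by (intro continuous_intros)
  then have [measurable]: "(\<lambda>F. indicator ?P F *\<^sub>R (F + deriv (real_val h) (det F) *\<^sub>R cofactor2 F)) \<in> borel_measurable borel"
    by (intro borel_measurable_continuous_on_indicator) measurable
  have "DW h = (\<lambda>F. if 0 < det F then indicator ?P F *\<^sub>R (F + deriv (real_val h) (det F) *\<^sub>R cofactor2 F)
      else if det F < 0 then 0 else D0)"
    using DW_formula[OF h] DW_eq_0[OF h] zero by (auto simp: fun_eq_iff not_less)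
  also have "\<dots> \<in> borel_measurable borel"
    by measurable
  finally show ?thesis .
qed

lemma borel_measurable_real_val_W:
  assumes h: "admissible_h h"
  shows "real_val (W h) \<in> borel_measurable borel"
proof -
  note [measurable] = borel_measurable_W[OF h]
  show ?thesis unfolding real_val_def[abs_def] by measurable
qed

lemma borel_measurable_vec2I:
  fixes f :: "'a \<Rightarrow> 'b::euclidean_space^2"
  assumes "\<And>i. (\<lambda>x. f x $ i) \<in> borel_measurable N"
  shows "f \<in> borel_measurable N"
  unfolding borel_measurable_euclidean_space[of f]
  by (auto simp: Basis_vec_def inner_axis intro!: borel_measurable_inner assms)

lemma borel_measurable_nth [measurable (raw)]:
  fixes f :: "'a \<Rightarrow> 'b::euclidean_space^'n"
  assumes "f \<in> borel_measurable N"
  shows "(\<lambda>x. f x $ i) \<in> borel_measurable N"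
  using measurable_compose[OF assms borel_measurable_continuous_onI[OF linear_continuous_on[OF bounded_linear_vec_nth]]] .

lemma borel_measurable_M:
  assumes h: "admissible_h h"
  shows "M h \<in> borel_measurable borel"
proof -
  note [measurable] = borel_measurable_real_val_W[OF h] borel_measurable_DW[OF h]
  show ?thesis
    unfolding M_def[abs_def] matrix_matrix_mult_def transpose_def mat_def
  proof (intro borel_measurable_vec2I)
    fix i j :: 2
    show "(\<lambda>F. ((\<chi> i j. \<Sum>k\<in>UNIV. (\<chi> i j. F $ j $ i) $ i $ k * DW h F $ k $ j)
        - real_val (W h) F *\<^sub>R (\<chi> i j. if i = j then 1 else 0)) $ i $ j) \<in> borel_measurable borel"
      by (cases "i = j") (simp_all add: sum_2)
  qed
qed

lemma transpose_mult_cofactor2: "transpose F ** cofactor2 F = det F *\<^sub>R mat 1"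
  by (simp add: vec_eq_iff forall_2 matrix_matrix_mult_def transpose_def sum_2 det_2 mat_def algebra_simps)

text \<open>The cofactor identity turns the \<open>h'\<close> part of
  \<open>transpose F ** DW h F\<close> into d h'(d) times the identity, which merges with -h(d) from
  \<open>-W\<close> to give f(d).\<close>

lemma M_formula:
  assumes h: "admissible_h h" and F: "0 < det F"
  shows "M h F = transpose F ** F + (f_aux h (det F) - (norm F)\<^sup>2 / 2) *\<^sub>R mat 1"
proof -
  have "M h F = transpose F ** F + deriv (real_val h) (det F) *\<^sub>R (transpose F ** cofactor2 F) - real_val (W h) F *\<^sub>R mat 1"
    unfolding M_def DW_formula[OF assms]
    by (simp add: matrix_add_ldistrib vec_eq_iff matrix_matrix_mult_def sum_distrib_left algebra_simps sum.distrib)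
  then show ?thesis
    unfolding transpose_mult_cofactor2 real_val_W[OF assms] f_aux_def
    by (simp add: algebra_simps)
qed

subsection \<open>Test fields and the moving frame\<close>

lemma C1cD:
  assumes "\<Phi> \<in> C1c \<Omega>"
  shows C1c_has_derivative: "(\<Phi> has_derivative frechet_derivative \<Phi> (at x)) (at x)"
    and C1c_eq_0: "x \<notin> \<Omega> \<Longrightarrow> \<Phi> x = 0"
  using assms by (auto simp: C1c_def frechet_derivative_works[symmetric])

lemma C1c_continuous:
  assumes "\<Phi> \<in> C1c \<Omega>" "continuous_on S f"
  shows "continuous_on S (\<lambda>p. \<Phi> (f p))"
proof -
  have "continuous_on UNIV \<Phi>"
    using C1c_has_derivative[OF assms(1)] has_derivative_continuous
    by (blast intro: continuous_at_imp_continuous_on)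
  then show ?thesis
    using assms(2) by (auto intro: continuous_on_compose2)
qed

text \<open>\<open>C1c\<close> provides continuity of the derivative for each fixed direction. Here
  the direction moves with the point, which is handled by expanding it in the standard
  basis.\<close>

lemma C1c_continuous_derivative:
  fixes \<Phi> :: "real^2 \<Rightarrow> 'b::real_normed_vector"
  assumes \<Phi>: "\<Phi> \<in> C1c \<Omega>" and f: "continuous_on S f" and v: "continuous_on S v"
  shows "continuous_on S (\<lambda>p. frechet_derivative \<Phi> (at (f p)) (v p))"
proof -
  have "frechet_derivative \<Phi> (at x) w =
      (w $ 1) *\<^sub>R frechet_derivative \<Phi> (at x) (axis 1 1) + (w $ 2) *\<^sub>R frechet_derivative \<Phi> (at x) (axis 2 1)" for x w
  proof -
    interpret bounded_linear "frechet_derivative \<Phi> (at x)"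
      by (rule has_derivative_bounded_linear[OF C1c_has_derivative[OF \<Phi>]])
    have "w = (w $ 1) *\<^sub>R axis 1 1 + (w $ 2) *\<^sub>R axis 2 1"
      by (simp add: vec_eq_iff forall_2 axis_def)
    then show ?thesis by (metis add scaleR)
  qed
  then have eq: "(\<lambda>p. frechet_derivative \<Phi> (at (f p)) (v p)) =
      (\<lambda>p. (v p $ 1) *\<^sub>R frechet_derivative \<Phi> (at (f p)) (axis 1 1)
        + (v p $ 2) *\<^sub>R frechet_derivative \<Phi> (at (f p)) (axis 2 1))"
    by (rule ext)
  have "continuous_on S (\<lambda>p. frechet_derivative \<Phi> (at (f p)) w)" for w
    using \<Phi> by (intro continuous_on_compose2[OF _ f]) (auto simp: C1c_def)
  then show ?thesis
    unfolding eq by (intro continuous_intros v)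
qed

lemma C1c_vector_derivative:
  assumes \<Phi>: "\<Phi> \<in> C1c \<Omega>" and f: "(f has_vector_derivative f') (at t)"
  shows "((\<lambda>t. \<Phi> (f t)) has_vector_derivative frechet_derivative \<Phi> (at (f t)) f') (at t)"
proof -
  interpret bounded_linear "frechet_derivative \<Phi> (at (f t))"
    by (rule has_derivative_bounded_linear[OF C1c_has_derivative[OF \<Phi>]])
  show ?thesis
    using has_derivative_compose[OF f[unfolded has_vector_derivative_def] C1c_has_derivative[OF \<Phi>]]
    by (simp add: has_vector_derivative_def scaleR)
qed

lemma C1c_radial_derivative:
  assumes "\<Phi> \<in> C1c \<Omega>"
  shows "((\<lambda>r. \<Phi> (r *\<^sub>R e_R \<theta>)) has_vector_derivative
     frechet_derivative \<Phi> (at (R *\<^sub>R e_R \<theta>)) (e_R \<theta>)) (at R)"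
  by (rule C1c_vector_derivative[OF assms]) (auto intro!: derivative_eq_intros)

lemma C1c_angular_derivative:
  assumes "\<Phi> \<in> C1c \<Omega>"
  shows "((\<lambda>t. \<Phi> (R *\<^sub>R e_R t)) has_vector_derivative
     frechet_derivative \<Phi> (at (R *\<^sub>R e_R \<theta>)) (R *\<^sub>R e_\<theta> \<theta>)) (at \<theta>)"
  by (rule C1c_vector_derivative[OF assms])
     (rule bounded_linear.has_vector_derivative[OF bounded_linear_scaleR_right e_R_has_vector_derivative])

lemma inner_vec2: "(a :: real^2) \<bullet> b = a $ 1 * b $ 1 + a $ 2 * b $ 2"
  by (simp add: inner_vec_def sum_2)

lemma e_R_e_\<theta>_inner [simp]:
  "e_R \<theta> \<bullet> e_R \<theta> = 1" "e_\<theta> \<theta> \<bullet> e_\<theta> \<theta> = 1" "e_R \<theta> \<bullet> e_\<theta> \<theta> = 0" "e_\<theta> \<theta> \<bullet> e_R \<theta> = 0"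
  using sin_squared_eq[of \<theta>] by (simp_all add: inner_vec2 power2_eq_square)

lemma grad_one_hom_mult: "grad_one_hom g g' \<theta> *v v = (e_R \<theta> \<bullet> v) *\<^sub>R g \<theta> + (e_\<theta> \<theta> \<bullet> v) *\<^sub>R g' \<theta>"
  by (simp add: grad_one_hom_def outer_def matrix_vector_mult_def vec_eq_iff forall_2 sum_2 inner_vec2 algebra_simps)

text \<open>The Frobenius product can be evaluated in any orthonormal basis, here the moving
  frame.\<close>

lemma matrix_inner_frame:
  fixes A B :: "real^2^2"
  shows "A \<bullet> B = (A *v e_R \<theta>) \<bullet> (B *v e_R \<theta>) + (A *v e_\<theta> \<theta>) \<bullet> (B *v e_\<theta> \<theta>)"
proof -
  have *: "(a1 * c + a2 * s) * (b1 * c + b2 * s) + (a2 * c - a1 * s) * (b2 * c - b1 * s) = (a1 * b1 + a2 * b2) * (c * c + s * s)"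
    for a1 a2 b1 b2 c s :: real
    by (simp add: algebra_simps)
  have "(A *v e_R \<theta>) $ i * (B *v e_R \<theta>) $ i + (A *v e_\<theta> \<theta>) $ i * (B *v e_\<theta> \<theta>) $ i = A$i$1 * B$i$1 + A$i$2 * B$i$2" for i
    using *[of "A$i$1" "cos \<theta>" "A$i$2" "sin \<theta>" "B$i$1" "B$i$2"]
    by (simp add: matrix_vector_mult_def sum_2)
  from this[of 1] this[of 2] show ?thesis
    by (simp add: inner_matrix2 inner_vec2)
qed

lemma norm_grad_one_hom: "(norm (grad_one_hom g g' \<theta>))\<^sup>2 = (norm (g \<theta>))\<^sup>2 + (norm (g' \<theta>))\<^sup>2"
  unfolding power2_norm_eq_inner matrix_inner_frame[of _ _ \<theta>] by (simp add: grad_one_hom_mult)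

text \<open>The gradient maps \<open>e_R\<close> to \<open>g\<close> and \<open>e_\<theta>\<close>
  to \<open>g'\<close>, so \<open>transpose F ** F\<close> is the Gram matrix of \<open>g\<close>,
  \<open>g'\<close> in the frame; the multiple of the identity in \<open>M_formula\<close> shifts
  its diagonal.\<close>

lemma M_grad_one_hom:
  assumes h: "admissible_h h" and d: "0 < det (grad_one_hom g g' \<theta>)"
  defines "f \<equiv> f_aux h (det (grad_one_hom g g' \<theta>))"
  shows "M h (grad_one_hom g g' \<theta>) *v e_R \<theta>
      = (f + (norm (g \<theta>))\<^sup>2 / 2 - (norm (g' \<theta>))\<^sup>2 / 2) *\<^sub>R e_R \<theta> + (g' \<theta> \<bullet> g \<theta>) *\<^sub>R e_\<theta> \<theta>"
    and "M h (grad_one_hom g g' \<theta>) *v e_\<theta> \<theta>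
      = (g' \<theta> \<bullet> g \<theta>) *\<^sub>R e_R \<theta> + (f + (norm (g' \<theta>))\<^sup>2 / 2 - (norm (g \<theta>))\<^sup>2 / 2) *\<^sub>R e_\<theta> \<theta>"
proof -
  let ?F = "grad_one_hom g g' \<theta>"
  have tr: "transpose ?F *v w = (g \<theta> \<bullet> w) *\<^sub>R e_R \<theta> + (g' \<theta> \<bullet> w) *\<^sub>R e_\<theta> \<theta>" for w
    by (simp add: grad_one_hom_def outer_def transpose_def matrix_vector_mult_def vec_eq_iff forall_2 sum_2 inner_vec2 algebra_simps)
  have M: "M h ?F *v w = transpose ?F *v (?F *v w) + (f - (norm (g \<theta>))\<^sup>2 / 2 - (norm (g' \<theta>))\<^sup>2 / 2) *\<^sub>R w" for w
    unfolding M_formula[OF h d] f_def norm_grad_one_hom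
    by (simp add: matrix_vector_mult_add_rdistrib scaleR_matrix_vector_assoc[symmetric]
        matrix_vector_mul_assoc add_divide_distrib diff_diff_eq)
  show "M h ?F *v e_R \<theta>
      = (f + (norm (g \<theta>))\<^sup>2 / 2 - (norm (g' \<theta>))\<^sup>2 / 2) *\<^sub>R e_R \<theta> + (g' \<theta> \<bullet> g \<theta>) *\<^sub>R e_\<theta> \<theta>"
    unfolding M tr grad_one_hom_mult
    by (simp add: power2_norm_eq_inner algebra_simps flip: scaleR_add_left)
  show "M h ?F *v e_\<theta> \<theta>
      = (g' \<theta> \<bullet> g \<theta>) *\<^sub>R e_R \<theta> + (f + (norm (g' \<theta>))\<^sup>2 / 2 - (norm (g \<theta>))\<^sup>2 / 2) *\<^sub>R e_\<theta> \<theta>"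
    unfolding M tr grad_one_hom_mult
    by (simp add: power2_norm_eq_inner inner_commute algebra_simps flip: scaleR_add_left)
qed

section \<open>Measurability of the fields\<close>

lemma borel_measurable_matrix_vector_mult2 [measurable (raw)]:
  fixes A :: "'a \<Rightarrow> real^2^2" and v :: "'a \<Rightarrow> real^2"
  assumes [measurable]: "A \<in> borel_measurable N" "v \<in> borel_measurable N"
  shows "(\<lambda>x. A x *v v x) \<in> borel_measurable N"
  by (intro borel_measurable_vec2I) (simp add: matrix_vector_mult_def sum_2)

lemma borel_measurable_e [measurable]:
  "e_R \<in> borel_measurable borel" "e_\<theta> \<in> borel_measurable borel"
  by (intro borel_measurable_continuous_onI continuous_intros)+

lemma borel_measurable_grad_one_hom [measurable (raw)]:
  assumes [measurable]: "g \<in> borel_measurable borel" "g' \<in> borel_measurable borel"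
  shows "grad_one_hom g g' \<in> borel_measurable borel"
  unfolding grad_one_hom_def[abs_def] outer_def
  by (intro borel_measurable_vec2I) simp

lemma borel_measurable_Arg2pi [measurable]: "Arg2pi \<in> borel_measurable borel"
  unfolding borel_measurable_iff_greater using open_Arg2pi2pi_gt by auto

lemma set_integrable_congI_AE:
  fixes f g :: "'a \<Rightarrow> 'b::{banach, second_countable_topology}"
  assumes g: "set_integrable N S g" and S: "S \<in> sets N" and f: "f \<in> borel_measurable N"
    and eq: "AE x in N. x \<in> S \<longrightarrow> f x = g x"
  shows "set_integrable N S f" "(LINT x:S|N. f x) = (LINT x:S|N. g x)"
proof -
  have 1: "(\<lambda>x. indicator S x *\<^sub>R f x) \<in> borel_measurable N"
    using S f by simp
  have 2: "(\<lambda>x. indicator S x *\<^sub>R g x) \<in> borel_measurable N"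
    using g by (auto simp: set_integrable_def dest: borel_measurable_integrable)
  have 3: "AE x in N. indicator S x *\<^sub>R f x = indicator S x *\<^sub>R g x"
    using eq by eventually_elim (auto simp: indicator_def)
  show "set_integrable N S f"
    using g integrable_cong_AE[OF 1 2 3] by (simp add: set_integrable_def)
  show "(LINT x:S|N. f x) = (LINT x:S|N. g x)"
    using integral_cong_AE[OF 1 2 3] by (simp add: set_lebesgue_integral_def)
qed

subsection \<open>Finite energy and weak derivatives on the circle\<close>

lemma ennreal_real_val_le: "ennreal (real_val f x) \<le> f x"
  by (cases "f x") (auto simp: real_val_def)

text \<open>\<open>W\<close> is infinite wherever the determinant is not positive, so finite energy
  confines this to a null set; and \<open>W\<close> dominates h(d), whose integrability later yields
  that of \<open>A\<close>.\<close>

lemma I_energy_finite: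
  assumes h: "admissible_h h" and fin: "I_energy h g g' < \<infinity>"
    and meas: "g \<in> borel_measurable borel" "g' \<in> borel_measurable borel"
  shows I_energy_det_pos: "AE \<theta> in lborel. \<theta> \<in> {0..2*pi} \<longrightarrow> 0 < det (grad_one_hom g g' \<theta>)"
    and I_energy_set_integrable_h:
      "set_integrable lborel {0..2*pi} (\<lambda>\<theta>. real_val h (det (grad_one_hom g g' \<theta>)))"
proof -
  note [measurable] = meas borel_measurable_W[OF h] borel_measurable_admissible_h[OF h]
  have [measurable]: "real_val h \<in> borel_measurable borel"
    unfolding real_val_def[abs_def] by measurable
  have "AE \<theta> in lborel. W h (grad_one_hom g g' \<theta>) * indicator {0..2*pi} \<theta> \<noteq> \<infinity>"
    using fin by (intro nn_integral_noteq_infinite) (auto simp: I_energy_def)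
  then show "AE \<theta> in lborel. \<theta> \<in> {0..2*pi} \<longrightarrow> 0 < det (grad_one_hom g g' \<theta>)"
    by eventually_elim (auto simp: W_finite_iff[OF h, symmetric] less_top)
  show "set_integrable lborel {0..2*pi} (\<lambda>\<theta>. real_val h (det (grad_one_hom g g' \<theta>)))"
    unfolding set_integrable_def
  proof (rule integrableI_bounded)
    have "ennreal (norm (indicator {0..2*pi} \<theta> *\<^sub>R real_val h (det (grad_one_hom g g' \<theta>))))
        \<le> W h (grad_one_hom g g' \<theta>) * indicator {0..2*pi} \<theta>" for \<theta>
    proof -
      have "ennreal (real_val h (det (grad_one_hom g g' \<theta>))) \<le> W h (grad_one_hom g g' \<theta>)"
        unfolding W_def by (rule order_trans[OF ennreal_real_val_le]) simp
      then show ?thesis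
        by (auto simp: indicator_def real_val_nonneg)
    qed
    then have "(\<integral>\<^sup>+\<theta>. ennreal (norm (indicator {0..2*pi} \<theta> *\<^sub>R real_val h (det (grad_one_hom g g' \<theta>)))) \<partial>lborel)
        \<le> I_energy h g g'"
      unfolding I_energy_def by (intro nn_integral_mono)
    also note fin
    finally show "(\<integral>\<^sup>+\<theta>. ennreal (norm (indicator {0..2*pi} \<theta> *\<^sub>R real_val h (det (grad_one_hom g g' \<theta>)))) \<partial>lborel) < \<infinity>" .
  qed measurable
qed

lemma set_integrable_square_integrable:
  fixes g :: "real \<Rightarrow> 'b::{banach, second_countable_topology}"
  assumes g: "set_integrable lborel {0..2*pi} (\<lambda>\<theta>. (norm (g \<theta>))\<^sup>2)"
    and [measurable]: "g \<in> borel_measurable borel"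
  shows "set_integrable lborel {0..2*pi} g"
  unfolding set_integrable_def
proof (rule Bochner_Integration.integrable_bound)
  have "set_integrable lborel {0..2*pi} (\<lambda>\<theta>. 1 :: real)"
    unfolding set_integrable_def by (simp add: emeasure_lborel_Icc_eq)
  then show "integrable lborel (\<lambda>\<theta>. indicator {0..2*pi} \<theta> *\<^sub>R ((norm (g \<theta>))\<^sup>2 + 1))"
    using set_integral_add(1)[OF g] by (simp add: set_integrable_def)
  have "norm (g \<theta>) \<le> (norm (g \<theta>))\<^sup>2 + 1" for \<theta>
  proof -
    have "0 \<le> (norm (g \<theta>) - 1)\<^sup>2 + norm (g \<theta>)" by simp
    then show ?thesis by (simp add: power2_diff)
  qed
  then show "AE \<theta> in lborel. norm (indicator {0..2*pi} \<theta> *\<^sub>R g \<theta>)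
      \<le> norm (indicator {0..2*pi} \<theta> *\<^sub>R ((norm (g \<theta>))\<^sup>2 + 1))"
    by (simp add: indicator_def)
qed measurable

lemma set_integrable_inner_square_integrable:
  fixes g g' :: "real \<Rightarrow> real^2"
  assumes g: "set_integrable lborel {0..2*pi} (\<lambda>\<theta>. (norm (g \<theta>))\<^sup>2)"
    and g': "set_integrable lborel {0..2*pi} (\<lambda>\<theta>. (norm (g' \<theta>))\<^sup>2)"
    and [measurable]: "g \<in> borel_measurable borel" "g' \<in> borel_measurable borel"
  shows "set_integrable lborel {0..2*pi} (\<lambda>\<theta>. g' \<theta> \<bullet> g \<theta>)"
  unfolding set_integrable_def
proof (rule Bochner_Integration.integrable_bound)
  show "integrable lborel (\<lambda>\<theta>. indicator {0..2*pi} \<theta> *\<^sub>R ((norm (g' \<theta>))\<^sup>2 + (norm (g \<theta>))\<^sup>2))"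
    using set_integral_add(1)[OF g' g] by (simp add: set_integrable_def)
  have "\<bar>g' \<theta> \<bullet> g \<theta>\<bar> \<le> (norm (g' \<theta>))\<^sup>2 + (norm (g \<theta>))\<^sup>2" for \<theta>
  proof -
    have "\<bar>g' \<theta> \<bullet> g \<theta>\<bar> \<le> norm (g' \<theta>) * norm (g \<theta>)"
      by (rule Cauchy_Schwarz_ineq2)
    moreover have "0 \<le> (norm (g' \<theta>) - norm (g \<theta>))\<^sup>2" "0 \<le> norm (g' \<theta>) * norm (g \<theta>)"
      by simp_all
    ultimately show ?thesis by (simp add: power2_diff)
  qed
  then show "AE \<theta> in lborel. norm (indicator {0..2*pi} \<theta> *\<^sub>R (g' \<theta> \<bullet> g \<theta>))
      \<le> norm (indicator {0..2*pi} \<theta> *\<^sub>R ((norm (g' \<theta>))\<^sup>2 + (norm (g \<theta>))\<^sup>2))"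
    by (simp add: indicator_def)
qed measurable

lemma set_integral_nth:
  fixes f :: "'a \<Rightarrow> real^2"
  assumes f: "set_integrable N S f"
  shows "set_integrable N S (\<lambda>x. f x $ i)" "(LINT x:S|N. f x $ i) = (LINT x:S|N. f x) $ i"
  using integrable_bounded_linear[OF bounded_linear_vec_nth f[unfolded set_integrable_def], of i]
    integral_bounded_linear[OF bounded_linear_vec_nth f[unfolded set_integrable_def], of i]
  by (simp_all add: set_integrable_def set_lebesgue_integral_def)

text \<open>Puts the weak derivative into the shape required by
  \<open>set_integral_polar_rect_weak\<close>, with the components of \<open>g\<close> and
  \<open>g'\<close> as coefficients, so that the weak gradient of \<open>one_hom g\<close> can use
  the same slicing argument as the equilibrium equation.\<close>

lemma W12_circle_weak_derivative_nth:
  assumes g: "W12_circle g g'" and \<phi>: "smooth_circle \<phi>"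
  shows "(LINT t:{0..2*pi}|lborel. g t $ i * deriv \<phi> t + g' t $ i * \<phi> t) = 0"
proof -
  have int: "set_integrable lborel {0..2*pi} g" "set_integrable lborel {0..2*pi} g'"
    using g by (auto simp: W12_circle_def intro: set_integrable_square_integrable)
  note i1 = set_integrable_continuous_scaleR[OF int(1) smooth_circle_continuous(2)[OF \<phi>]]
  note i2 = set_integrable_continuous_scaleR[OF int(2) smooth_circle_continuous(1)[OF \<phi>]]
  have "(LINT t:{0..2*pi}|lborel. deriv \<phi> t *\<^sub>R g t) + (LINT t:{0..2*pi}|lborel. \<phi> t *\<^sub>R g' t) = 0"
    using g \<phi> by (simp add: W12_circle_def)
  then have "(LINT t:{0..2*pi}|lborel. (deriv \<phi> t *\<^sub>R g t) $ i) + (LINT t:{0..2*pi}|lborel. (\<phi> t *\<^sub>R g' t) $ i) = 0"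
    unfolding set_integral_nth(2)[OF i1] set_integral_nth(2)[OF i2] vector_add_component[symmetric] by simp
  then show ?thesis
    using set_integral_add(2)[OF set_integral_nth(1)[OF i1, of i] set_integral_nth(1)[OF i2, of i]]
    by (simp add: mult.commute)
qed

lemma borel_measurable_fst_snd_borel [measurable]:
  "(fst :: real \<times> real \<Rightarrow> real) \<in> borel_measurable borel" "(snd :: real \<times> real \<Rightarrow> real) \<in> borel_measurable borel"
  by (intro borel_measurable_continuous_onI continuous_intros)+

lemma C1c_borel_measurable:
  fixes \<Phi> :: "real^2 \<Rightarrow> 'b::real_normed_vector"
  assumes \<Phi>: "\<Phi> \<in> C1c \<Omega>"
  shows "\<Phi> \<in> borel_measurable borel"
    "(\<lambda>x. frechet_derivative \<Phi> (at x) w) \<in> borel_measurable borel"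
    "(\<lambda>p. frechet_derivative \<Phi> (at (fst p *\<^sub>R e_R (snd p))) (fst p *\<^sub>R e_\<theta> (snd p))) \<in> borel_measurable borel"
  by (intro borel_measurable_continuous_onI C1c_continuous[OF \<Phi>] C1c_continuous_derivative[OF \<Phi>] continuous_intros)+

subsection \<open>The equilibrium equation in polar form\<close>

lemma inner_e_angular_derivative:
  assumes "\<Phi> \<in> C1c \<Omega>"
  shows "((\<lambda>t. e_R t \<bullet> \<Phi> (R *\<^sub>R e_R t)) has_real_derivative
      e_R \<theta> \<bullet> frechet_derivative \<Phi> (at (R *\<^sub>R e_R \<theta>)) (R *\<^sub>R e_\<theta> \<theta>) + e_\<theta> \<theta> \<bullet> \<Phi> (R *\<^sub>R e_R \<theta>)) (at \<theta>)"
    and "((\<lambda>t. e_\<theta> t \<bullet> \<Phi> (R *\<^sub>R e_R t)) has_real_derivative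
      e_\<theta> \<theta> \<bullet> frechet_derivative \<Phi> (at (R *\<^sub>R e_R \<theta>)) (R *\<^sub>R e_\<theta> \<theta>) - e_R \<theta> \<bullet> \<Phi> (R *\<^sub>R e_R \<theta>)) (at \<theta>)"
  unfolding has_real_derivative_iff_has_vector_derivative
  using bounded_bilinear.has_vector_derivative[OF bounded_bilinear_inner e_R_has_vector_derivative C1c_angular_derivative[OF assms, of R \<theta>]]
    bounded_bilinear.has_vector_derivative[OF bounded_bilinear_inner e_\<theta>_has_vector_derivative C1c_angular_derivative[OF assms, of R \<theta>]]
  by (simp_all add: inner_minus_left)

lemma inner_radial_derivative:
  assumes "\<Phi> \<in> C1c \<Omega>" "R \<noteq> 0"
  shows "((\<lambda>r. (v \<bullet> \<Phi> (r *\<^sub>R e_R \<theta>)) / r) has_real_derivative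
      (v \<bullet> frechet_derivative \<Phi> (at (R *\<^sub>R e_R \<theta>)) (e_R \<theta>)) / R - (v \<bullet> \<Phi> (R *\<^sub>R e_R \<theta>)) / R\<^sup>2) (at R)"
proof -
  have "((\<lambda>r. v \<bullet> \<Phi> (r *\<^sub>R e_R \<theta>)) has_real_derivative v \<bullet> frechet_derivative \<Phi> (at (R *\<^sub>R e_R \<theta>)) (e_R \<theta>)) (at R)"
    unfolding has_real_derivative_iff_has_vector_derivative
    by (rule bounded_linear.has_vector_derivative[OF bounded_linear_inner_right C1c_radial_derivative[OF assms(1)]])
  from DERIV_divide[OF this DERIV_ident assms(2)] show ?thesis
    using assms(2) by (simp add: field_simps power2_eq_square)
qed

lemma e_periodic: "e_R (\<theta> + 2 * pi) = e_R \<theta>" "e_\<theta> (\<theta> + 2 * pi) = e_\<theta> \<theta>"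
  by (simp_all add: e_R_def e_\<theta>_def)

text \<open>The integrand of the polar equation in the moving frame, for a test field \<open>\<Phi> = p e_R + q e_\<theta>\<close>:
  \<open>((p' B + p C) + (q' A + q 0)) / R\<^sup>2\<close>, where \<open>A\<close> and \<open>B, C\<close> are the coefficients of the two given
  equations on the circle. The vanishing last term makes both summands instances of the same weak
  equation.\<close>

definition polar_density ::
    "(real \<Rightarrow> real) \<Rightarrow> (real \<Rightarrow> real) \<Rightarrow> (real \<Rightarrow> real) \<Rightarrow> (real^2 \<Rightarrow> real^2) \<Rightarrow> real \<times> real \<Rightarrow> real" where
  "polar_density A B C \<Phi> p =
     (let v = \<Phi> (fst p *\<^sub>R e_R (snd p));
          w = frechet_derivative \<Phi> (at (fst p *\<^sub>R e_R (snd p))) (fst p *\<^sub>R e_\<theta> (snd p));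
          r = e_R (snd p); s = e_\<theta> (snd p)
      in ((r \<bullet> w + s \<bullet> v) / (fst p)\<^sup>2 * B (snd p) + (r \<bullet> v) / (fst p)\<^sup>2 * C (snd p))
         + ((s \<bullet> w - r \<bullet> v) / (fst p)\<^sup>2 * A (snd p) + (s \<bullet> v) / (fst p)\<^sup>2 * 0))"

lemma
  assumes \<Phi>: "\<Phi> \<in> C1c \<Omega>" and R: "0 < R0"
    and A: "set_integrable lborel {0..2*pi} A" and B: "set_integrable lborel {0..2*pi} B"
    and C: "set_integrable lborel {0..2*pi} C"
    and weakA: "\<And>\<phi>. smooth_circle \<phi> \<Longrightarrow> (LINT t:{0..2*pi}|lborel. A t * deriv \<phi> t) = 0"
    and weakBC: "\<And>\<phi>. smooth_circle \<phi> \<Longrightarrow> (LINT t:{0..2*pi}|lborel. B t * deriv \<phi> t + C t * \<phi> t) = 0"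
  shows polar_density_integrable: "set_integrable lborel (polar_rect R0 R1) (polar_density A B C \<Phi>)"
    and polar_density_integral: "(LINT p:polar_rect R0 R1|lborel. polar_density A B C \<Phi> p) = 0"
proof -
  let ?v = "\<lambda>p. \<Phi> (fst p *\<^sub>R e_R (snd p))"
  let ?w = "\<lambda>p. frechet_derivative \<Phi> (at (fst p *\<^sub>R e_R (snd p))) (fst p *\<^sub>R e_\<theta> (snd p))"
  have cont: "continuous_on S ?v" "continuous_on S ?w" for S
    by (intro C1c_continuous[OF \<Phi>] C1c_continuous_derivative[OF \<Phi>] continuous_intros)+
  have nz: "\<forall>p\<in>{R0..R1} \<times> UNIV. (fst p)\<^sup>2 \<noteq> 0"
    using R by auto
  have Z: "set_integrable lborel {0..2*pi} (\<lambda>t. 0 :: real)"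
    by (simp add: set_integrable_def)
  have wA: "(LINT t:{0..2*pi}|lborel. A t * deriv \<phi> t + 0 * \<phi> t) = 0" if "smooth_circle \<phi>" for \<phi>
    using weakA[OF that] by simp
  let ?\<psi>1 = "\<lambda>p. (e_R (snd p) \<bullet> ?v p) / (fst p)\<^sup>2"
  let ?\<psi>1' = "\<lambda>p. (e_R (snd p) \<bullet> ?w p + e_\<theta> (snd p) \<bullet> ?v p) / (fst p)\<^sup>2"
  let ?\<psi>2 = "\<lambda>p. (e_\<theta> (snd p) \<bullet> ?v p) / (fst p)\<^sup>2"
  let ?\<psi>2' = "\<lambda>p. (e_\<theta> (snd p) \<bullet> ?w p - e_R (snd p) \<bullet> ?v p) / (fst p)\<^sup>2"
  have c: "continuous_on ({R0..R1} \<times> UNIV) ?\<psi>1" "continuous_on ({R0..R1} \<times> UNIV) ?\<psi>1'"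
      "continuous_on ({R0..R1} \<times> UNIV) ?\<psi>2" "continuous_on ({R0..R1} \<times> UNIV) ?\<psi>2'"
    by (intro continuous_intros cont nz)+
  have d1: "((\<lambda>t. ?\<psi>1 (R, t)) has_real_derivative ?\<psi>1' (R, \<theta>)) (at \<theta>)" for R \<theta>
    using DERIV_cdivide[OF inner_e_angular_derivative(1)[OF \<Phi>]] by simp
  have d2: "((\<lambda>t. ?\<psi>2 (R, t)) has_real_derivative ?\<psi>2' (R, \<theta>)) (at \<theta>)" for R \<theta>
    using DERIV_cdivide[OF inner_e_angular_derivative(2)[OF \<Phi>]] by simp
  have p: "?\<psi>1 (R, \<theta> + 2 * pi) = ?\<psi>1 (R, \<theta>)" "?\<psi>2 (R, \<theta> + 2 * pi) = ?\<psi>2 (R, \<theta>)" for R \<theta>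
    by (simp_all add: e_periodic)
  have i1: "set_integrable lborel (polar_rect R0 R1) (\<lambda>p. ?\<psi>1' p * B (snd p) + ?\<psi>1 p * C (snd p))"
    by (rule set_integrable_polar_rect_weak[OF B C weakBC c(1,2) d1 p(1)])
  have i2: "set_integrable lborel (polar_rect R0 R1) (\<lambda>p. ?\<psi>2' p * A (snd p) + ?\<psi>2 p * 0)"
    by (rule set_integrable_polar_rect_weak[OF A Z wA c(3,4) d2 p(2)])
  have z1: "(LINT p:polar_rect R0 R1|lborel. ?\<psi>1' p * B (snd p) + ?\<psi>1 p * C (snd p)) = 0"
    by (rule set_integral_polar_rect_weak[OF B C weakBC c(1,2) d1 p(1)])
  have z2: "(LINT p:polar_rect R0 R1|lborel. ?\<psi>2' p * A (snd p) + ?\<psi>2 p * 0) = 0"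
    by (rule set_integral_polar_rect_weak[OF A Z wA c(3,4) d2 p(2)])
  have eq: "polar_density A B C \<Phi> = (\<lambda>p. (?\<psi>1' p * B (snd p) + ?\<psi>1 p * C (snd p)) + (?\<psi>2' p * A (snd p) + ?\<psi>2 p * 0))"
    by (rule ext) (simp only: polar_density_def Let_def)
  show "set_integrable lborel (polar_rect R0 R1) (polar_density A B C \<Phi>)"
    unfolding eq by (rule set_integral_add(1)[OF i1 i2])
  show "(LINT p:polar_rect R0 R1|lborel. polar_density A B C \<Phi> p) = 0"
    unfolding eq set_integral_add(2)[OF i1 i2] z1 z2 by simp
qed

text \<open>Both diagonal entries of \<open>M\<close> in the frame are written through
  \<open>A\<close>, so that integrability of \<open>A\<close> and of the squares covers every
  entry.\<close>

lemma
  assumes h: "admissible_h h" and d: "0 < det (grad_one_hom g g' \<theta>)"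
    and "f = f_aux h (det (grad_one_hom g g' \<theta>))"
    and A: "A = f + (norm (g' \<theta>))\<^sup>2 / 2 - (norm (g \<theta>))\<^sup>2 / 2"
    and B: "B = g' \<theta> \<bullet> g \<theta>"
  shows M_e_R_inner: "(M h (grad_one_hom g g' \<theta>) *v e_R \<theta>) \<bullet> v
      = (e_R \<theta> \<bullet> v) * (A + (norm (g \<theta>))\<^sup>2 - (norm (g' \<theta>))\<^sup>2) + (e_\<theta> \<theta> \<bullet> v) * B"
    and M_e_\<theta>_inner: "(M h (grad_one_hom g g' \<theta>) *v e_\<theta> \<theta>) \<bullet> v
      = (e_R \<theta> \<bullet> v) * B + (e_\<theta> \<theta> \<bullet> v) * A"
  unfolding M_grad_one_hom[OF h d] assms(3-5)
  by (simp_all add: inner_add_left field_simps)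

text \<open>The two \<open>B\<close> terms combine to the derivative of
  \<open>e_R \<bullet> \<Phi>\<close>. The derivative of \<open>e_\<theta> \<bullet> \<Phi>\<close>
  contributes \<open>-A\<close> to the factor of \<open>e_R \<bullet> \<Phi>\<close>, so the
  identity amounts to M e_R . e_R + 2 W = C - A, which is f(d) + h(d) = d h'(d).\<close>

lemma polar_integrand_eq:
  assumes h: "admissible_h h" and F: "0 < det (grad_one_hom g g' (snd p))"
  defines "F \<equiv> grad_one_hom g g'"
  defines "d \<equiv> \<lambda>\<theta>. det (F \<theta>)"
  defines "A \<equiv> \<lambda>\<theta>. f_aux h (d \<theta>) + (norm (g' \<theta>))\<^sup>2 / 2 - (norm (g \<theta>))\<^sup>2 / 2"
    and "B \<equiv> \<lambda>\<theta>. g' \<theta> \<bullet> g \<theta>"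
    and "C \<equiv> \<lambda>\<theta>. (norm (g' \<theta>))\<^sup>2 + (norm (g \<theta>))\<^sup>2 + 2 * d \<theta> * deriv (real_val h) (d \<theta>)"
  shows "((M h (F (snd p)) *v e_R (snd p) + (2 * real_val (W h) (F (snd p))) *\<^sub>R e_R (snd p)) \<bullet> \<Phi> (fst p *\<^sub>R e_R (snd p))
      + (M h (F (snd p)) *v e_\<theta> (snd p)) \<bullet> frechet_derivative \<Phi> (at (fst p *\<^sub>R e_R (snd p))) (fst p *\<^sub>R e_\<theta> (snd p))) / (fst p)\<^sup>2
    = polar_density A B C \<Phi> p"
proof -
  note MR = M_e_R_inner[OF h F refl refl refl] and M\<theta> = M_e_\<theta>_inner[OF h F refl refl refl]
  show ?thesis
    unfolding polar_density_def Let_def F_def inner_add_left MR M\<theta> real_val_W[OF h F] norm_grad_one_hom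
      A_def B_def C_def d_def f_aux_def
    by (simp add: divide_simps) (simp add: algebra_simps)
qed

subsection \<open>The one-homogeneous extension\<close>

abbreviation (input) polar_angle :: "real^2 \<Rightarrow> real" where
  "polar_angle x \<equiv> Arg2pi (Complex (x $ 1) (x $ 2))"

lemma borel_measurable_polar_angle [measurable]: "polar_angle \<in> borel_measurable borel"
proof -
  have "continuous_on UNIV (\<lambda>x :: real^2. Complex (x $ 1) (x $ 2))"
    unfolding Complex_eq by (intro continuous_intros)
  then have [measurable]: "(\<lambda>x :: real^2. Complex (x $ 1) (x $ 2)) \<in> borel_measurable borel"
    by (rule borel_measurable_continuous_onI)
  show ?thesis by measurable
qed

text \<open>\<open>Arg2pi\<close> takes values below \<open>2 * pi\<close>, so the identity fails on
  the closing edge of the rectangle, a null set.\<close>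

lemma AE_polar_angle:
  assumes "0 < R0"
  shows "AE p in lborel. p \<in> polar_rect R0 R1 \<longrightarrow> polar_angle (fst p *\<^sub>R e_R (snd p)) = snd p"
  using AE_snd_lborel[OF AE_lborel_singleton[of "2 * pi"]]
proof eventually_elim
  case (elim p)
  show ?case
  proof
    assume "p \<in> polar_rect R0 R1"
    with elim assms show "polar_angle (fst p *\<^sub>R e_R (snd p)) = snd p"
      by (intro Arg2pi_polar) (auto simp: mem_Times_iff)
  qed
qed

text \<open>Used with \<open>n = 1\<close> for the map itself and with \<open>n = 0\<close> for its
  gradient. The proof passes to norms because \<open>set_integrable_polar_rect\<close> is about real
  coefficients.\<close>

lemma set_integrable_annulus_homogeneous:
  fixes K :: "real \<Rightarrow> 'b::{banach, second_countable_topology}"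
  assumes R0: "0 < R0" and K: "set_integrable lborel {0..2*pi} K"
    and [measurable]: "K \<in> borel_measurable borel"
  shows "set_integrable lborel (annulus R0 R1) (\<lambda>x. norm x ^ n *\<^sub>R K (polar_angle x))"
proof -
  have f: "(\<lambda>x. norm (norm x ^ n *\<^sub>R K (polar_angle x))) \<in> borel_measurable borel"
    by measurable
  have "set_integrable lborel {0..2*pi} (\<lambda>\<theta>. norm (K \<theta>))"
    using K by (rule set_integrable_norm)
  then have "set_integrable lborel (polar_rect R0 R1) (\<lambda>p. (fst p * fst p ^ n) * norm (K (snd p)))"
    by (intro set_integrable_polar_rect continuous_intros)
  then have "set_integrable lborel (polar_rect R0 R1)
      (\<lambda>p. fst p *\<^sub>R norm (norm (fst p *\<^sub>R e_R (snd p)) ^ n *\<^sub>R K (polar_angle (fst p *\<^sub>R e_R (snd p)))))"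
  proof (rule set_integrable_congI_AE)
    show "(\<lambda>p. fst p *\<^sub>R norm (norm (fst p *\<^sub>R e_R (snd p)) ^ n *\<^sub>R K (polar_angle (fst p *\<^sub>R e_R (snd p)))))
        \<in> borel_measurable lborel"
      using measurable_compose[OF polar_map_measurable f] by simp
    show "AE p in lborel. p \<in> polar_rect R0 R1 \<longrightarrow>
        fst p *\<^sub>R norm (norm (fst p *\<^sub>R e_R (snd p)) ^ n *\<^sub>R K (polar_angle (fst p *\<^sub>R e_R (snd p))))
        = (fst p * fst p ^ n) * norm (K (snd p))"
      using AE_polar_angle[OF R0] by eventually_elim (use R0 in auto)
  qed simp
  then have "set_integrable lborel (annulus R0 R1) (\<lambda>x. norm (norm x ^ n *\<^sub>R K (polar_angle x)))"
    by (simp only: set_integrable_polar[OF R0 f])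
  then have "integrable lborel (\<lambda>x. norm (indicator (annulus R0 R1) x *\<^sub>R (norm x ^ n *\<^sub>R K (polar_angle x))))"
    by (simp add: set_integrable_def mult.assoc)
  then show ?thesis
    unfolding set_integrable_def by (rule integrable_norm_cancel) measurable
qed

text \<open>The area element and the weight combine to 1/R, which is at most 1/R0; by Tonelli's
  theorem the energy is bounded by \<open>I_energy\<close> times the length of the radial interval
  over \<open>R0\<close>.\<close>

lemma E_energy_one_hom_finite:
  assumes h: "admissible_h h" and fin: "I_energy h g g' < \<infinity>" and R0: "0 < R0"
    and meas [measurable]: "g \<in> borel_measurable borel" "g' \<in> borel_measurable borel"
  shows "E_energy h (annulus R0 R1) (\<lambda>x. grad_one_hom g g' (polar_angle x)) < \<infinity>"
proof -
  note [measurable] = borel_measurable_W[OF h] borel_measurable_grad_one_hom[OF meas]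
  let ?F = "grad_one_hom g g'"
  have "E_energy h (annulus R0 R1) (\<lambda>x. ?F (polar_angle x))
      = (\<integral>\<^sup>+p\<in>polar_rect R0 R1. ennreal (fst p) * (ennreal (1 / (norm (fst p *\<^sub>R e_R (snd p)))\<^sup>2)
          * W h (?F (polar_angle (fst p *\<^sub>R e_R (snd p))))) \<partial>lborel)"
    unfolding E_energy_def by (intro nn_integral_polar[OF R0]) measurable
  also have "\<dots> \<le> (\<integral>\<^sup>+p. (ennreal (1 / R0) * indicator {R0<..<R1} (fst p))
          * (W h (?F (snd p)) * indicator {0..2*pi} (snd p)) \<partial>lborel)"
  proof (rule nn_integral_mono_AE)
    show "AE p in lborel. ennreal (fst p) * (ennreal (1 / (norm (fst p *\<^sub>R e_R (snd p)))\<^sup>2)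
          * W h (?F (polar_angle (fst p *\<^sub>R e_R (snd p))))) * indicator (polar_rect R0 R1) p
        \<le> (ennreal (1 / R0) * indicator {R0<..<R1} (fst p)) * (W h (?F (snd p)) * indicator {0..2*pi} (snd p))"
      using AE_polar_angle[OF R0, of R1]
    proof eventually_elim
      case (elim p)
      show ?case
      proof (cases "p \<in> polar_rect R0 R1")
        case True
        then have p: "R0 < fst p" "fst p \<in> {R0<..<R1}" "snd p \<in> {0..2*pi}" by (auto simp: mem_Times_iff)
        have "ennreal (fst p) * ennreal (1 / (fst p)\<^sup>2) = ennreal (1 / fst p)"
          using p R0 by (simp add: ennreal_mult[symmetric] power2_eq_square)
        moreover have "ennreal (1 / fst p) \<le> ennreal (1 / R0)"
          using p R0 by (intro ennreal_leI) (simp add: frac_le)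
        ultimately show ?thesis
          using True p elim R0 by (simp add: mult.assoc[symmetric] mult_right_mono)
      qed simp
    qed
  qed
  also have "\<dots> = (\<integral>\<^sup>+p. (ennreal (1 / R0) * indicator {R0<..<R1} (fst p))
          * (W h (?F (snd p)) * indicator {0..2*pi} (snd p)) \<partial>(lborel \<Otimes>\<^sub>M lborel))"
    by (simp add: lborel_prod)
  also have "\<dots> = (\<integral>\<^sup>+R. (\<integral>\<^sup>+\<theta>. (ennreal (1 / R0) * indicator {R0<..<R1} R)
          * (W h (?F \<theta>) * indicator {0..2*pi} \<theta>) \<partial>lborel) \<partial>lborel)"
  proof (subst lborel.nn_integral_fst[symmetric])
    show "(\<lambda>p. (ennreal (1 / R0) * indicator {R0<..<R1} (fst p))
          * (W h (?F (snd p)) * indicator {0..2*pi} (snd p))) \<in> borel_measurable (lborel \<Otimes>\<^sub>M lborel)"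
      unfolding lborel_prod measurable_lborel2 by measurable
  qed simp
  also have "\<dots> = (\<integral>\<^sup>+R. (ennreal (1 / R0) * indicator {R0<..<R1} R) * I_energy h g g' \<partial>lborel)"
    unfolding I_energy_def by (intro nn_integral_cong nn_integral_cmult) measurable
  also have "\<dots> = ennreal (1 / R0) * emeasure lborel {R0<..<R1} * I_energy h g g'"
    by (simp add: nn_integral_multc nn_integral_cmult)
  also have "\<dots> < \<infinity>"
    using fin emeasure_bounded_finite[of "{R0<..<R1}"] by (auto simp: ennreal_mult_less_top)
  finally show ?thesis .
qed

lemma one_hom_has_weak_gradient:
  assumes g: "W12_circle g g'" and R: "0 < R0" "R0 < R1"
  shows "has_weak_gradient (one_hom g) (\<lambda>x. grad_one_hom g g' (polar_angle x)) (annulus R0 R1)"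
  unfolding has_weak_gradient_def
proof (intro conjI allI ballI impI)
  let ?F = "grad_one_hom g g'" and ?P = "\<lambda>p. fst p *\<^sub>R e_R (snd p)"
  have meas [measurable]: "g \<in> borel_measurable borel" "g' \<in> borel_measurable borel"
    and sq: "set_integrable lborel {0..2*pi} (\<lambda>\<theta>. (norm (g \<theta>))\<^sup>2)" "set_integrable lborel {0..2*pi} (\<lambda>\<theta>. (norm (g' \<theta>))\<^sup>2)"
    using g by (auto simp: W12_circle_def)
  have [measurable]: "?F \<in> borel_measurable borel"
    by (rule borel_measurable_grad_one_hom) measurable
  have ig: "set_integrable lborel {0..2*pi} g" "set_integrable lborel {0..2*pi} g'"
    by (rule set_integrable_square_integrable[OF sq(1) meas(1)] set_integrable_square_integrable[OF sq(2) meas(2)])+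
  have iF: "set_integrable lborel {0..2*pi} ?F"
  proof (rule set_integrable_square_integrable)
    show "set_integrable lborel {0..2*pi} (\<lambda>\<theta>. (norm (?F \<theta>))\<^sup>2)"
      unfolding norm_grad_one_hom by (rule set_integral_add(1)[OF sq])
  qed measurable
  have u_eq: "one_hom g = (\<lambda>x. norm x ^ 1 *\<^sub>R g (polar_angle x))"
    by (simp add: one_hom_def fun_eq_iff)
  have [measurable]: "one_hom g \<in> borel_measurable borel"
    unfolding u_eq by measurable
  {
    fix K assume K: "compact K \<and> K \<subseteq> annulus R0 R1"
    then have K': "K \<in> sets lborel" by (auto dest: compact_imp_closed)
    show "set_integrable lborel K (one_hom g)"
      unfolding u_eq
      using set_integrable_annulus_homogeneous[OF R(1) ig(1) meas(1), of R1 1] K K' by (auto intro: set_integrable_subset)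
    show "set_integrable lborel K (\<lambda>x. ?F (polar_angle x))"
      using set_integrable_annulus_homogeneous[OF R(1) iF, of R1 0] K K' by (auto intro: set_integrable_subset)
  next
    fix \<eta> :: "real^2 \<Rightarrow> real" and i j :: 2
    assume \<eta>: "\<eta> \<in> C1c (annulus R0 R1)"
    note [measurable] = C1c_borel_measurable[OF \<eta>]
    let ?D = "\<lambda>p. frechet_derivative \<eta> (at (?P p))"
    have cont: "continuous_on S (\<lambda>p. \<eta> (?P p))" "continuous_on S (\<lambda>p. ?D p w)"
        "continuous_on S (\<lambda>p. ?D p (e_R (snd p)))" "continuous_on S (\<lambda>p. ?D p (fst p *\<^sub>R e_\<theta> (snd p)))" for S w
      by (intro C1c_continuous[OF \<eta>] C1c_continuous_derivative[OF \<eta>] continuous_intros)+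
    have D: "?D p (axis j 1) = e_R (snd p) $ j * ?D p (e_R (snd p)) + e_\<theta> (snd p) $ j * ?D p (e_\<theta> (snd p))"
      and D': "?D p (fst p *\<^sub>R e_\<theta> (snd p)) = fst p * ?D p (e_\<theta> (snd p))" for p
    proof -
      interpret bounded_linear "?D p"
        by (rule has_derivative_bounded_linear[OF C1c_has_derivative[OF \<eta>]])
      have "axis j 1 = (e_R (snd p) $ j) *\<^sub>R e_R (snd p) + (e_\<theta> (snd p) $ j) *\<^sub>R e_\<theta> (snd p)"
        using exhaust_2[of j] sin_squared_eq[of "snd p"]
        by (auto simp: vec_eq_iff forall_2 axis_def power2_eq_square)
      then show "?D p (axis j 1) = e_R (snd p) $ j * ?D p (e_R (snd p)) + e_\<theta> (snd p) $ j * ?D p (e_\<theta> (snd p))"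
        by (simp add: add scaleR)
      show "?D p (fst p *\<^sub>R e_\<theta> (snd p)) = fst p * ?D p (e_\<theta> (snd p))"
        by (simp add: scaleR)
    qed
    note int = set_integral_nth(1)[OF ig(1), of i] set_integral_nth(1)[OF ig(2), of i]
    note rect = set_integrable_polar_rect[OF int(1), of R0 R1] set_integrable_polar_rect[OF int(2), of R0 R1]
    let ?X = "\<lambda>x. one_hom g x $ i * frechet_derivative \<eta> (at x) (axis j 1)"
    let ?Y = "\<lambda>x. ?F (polar_angle x) $ i $ j * \<eta> x"
    have [measurable]: "?X \<in> borel_measurable borel" "?Y \<in> borel_measurable borel"
      by measurable
    have m: "(\<lambda>p. fst p *\<^sub>R ?X (?P p)) \<in> borel_measurable lborel" "(\<lambda>p. fst p *\<^sub>R ?Y (?P p)) \<in> borel_measurable lborel"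
      using measurable_compose[OF polar_map_measurable \<open>?X \<in> borel_measurable borel\<close>]
        measurable_compose[OF polar_map_measurable \<open>?Y \<in> borel_measurable borel\<close>] by simp_all
    let ?x = "\<lambda>p. ((fst p)\<^sup>2 * ?D p (axis j 1)) * g (snd p) $ i"
    let ?y = "\<lambda>p. (fst p * \<eta> (?P p) * e_R (snd p) $ j) * g (snd p) $ i
        + (fst p * \<eta> (?P p) * e_\<theta> (snd p) $ j) * g' (snd p) $ i"
    have ix: "set_integrable lborel (polar_rect R0 R1) ?x"
      by (intro rect continuous_intros cont)
    have iy: "set_integrable lborel (polar_rect R0 R1) ?y"
      by (intro set_integral_add rect continuous_intros cont)
    have ex: "AE p in lborel. p \<in> polar_rect R0 R1 \<longrightarrow> fst p *\<^sub>R ?X (?P p) = ?x p"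
      using AE_polar_angle[OF R(1)] by eventually_elim (use R in \<open>auto simp: one_hom_def power2_eq_square\<close>)
    have ey: "AE p in lborel. p \<in> polar_rect R0 R1 \<longrightarrow> fst p *\<^sub>R ?Y (?P p) = ?y p"
      using AE_polar_angle[OF R(1)]
      by eventually_elim (auto simp: grad_one_hom_def outer_def algebra_simps)
    have X: "(LINT x:annulus R0 R1|lborel. ?X x) = (LINT p:polar_rect R0 R1|lborel. ?x p)"
      unfolding set_integral_polar[OF R(1) \<open>?X \<in> borel_measurable borel\<close>]
      by (rule set_integrable_congI_AE(2)[OF ix _ m(1) ex]) simp
    have Y: "(LINT x:annulus R0 R1|lborel. ?Y x) = (LINT p:polar_rect R0 R1|lborel. ?y p)"
      unfolding set_integral_polar[OF R(1) \<open>?Y \<in> borel_measurable borel\<close>]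
      by (rule set_integrable_congI_AE(2)[OF iy _ m(2) ey]) simp
    \<comment> \<open>\<open>?c\<close> is the \<open>R\<close>-derivative of R^2 \<eta> times the
      \<open>j\<close>-th component of \<open>e_R\<close>. It has one R \<eta> too many compared
      with the sum of \<open>?x\<close> and \<open>?y\<close>; the surplus is cancelled by the term
      that differentiating \<open>e_\<theta>\<close> produces in \<open>?\<psi>'\<close>.\<close>
    let ?c = "\<lambda>p. ((fst p)\<^sup>2 * ?D p (e_R (snd p)) + 2 * fst p * \<eta> (?P p)) * e_R (snd p) $ j"
    let ?\<psi> = "\<lambda>p. fst p * (e_\<theta> (snd p) $ j * \<eta> (?P p))"
    let ?\<psi>' = "\<lambda>p. fst p * (e_\<theta> (snd p) $ j * ?D p (fst p *\<^sub>R e_\<theta> (snd p)) - e_R (snd p) $ j * \<eta> (?P p))"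
    have c: "continuous_on S ?c" "continuous_on S ?\<psi>" "continuous_on S ?\<psi>'" for S
      by (intro continuous_intros cont)+
    have radial: "(LINT p:polar_rect R0 R1|lborel. ?c p * g (snd p) $ i) = 0"
    proof (rule set_integral_polar_rect_radial_derivative[OF int(1) c(1)])
      fix r \<theta>
      show "((\<lambda>r. r\<^sup>2 * \<eta> (r *\<^sub>R e_R \<theta>) * e_R \<theta> $ j) has_real_derivative ?c (r, \<theta>)) (at r)"
        using C1c_radial_derivative[OF \<eta>, of \<theta> r] unfolding has_real_derivative_iff_has_vector_derivative[symmetric]
        by (auto intro!: derivative_eq_intros)
      have "R0 *\<^sub>R e_R \<theta> \<notin> annulus R0 R1" "R1 *\<^sub>R e_R \<theta> \<notin> annulus R0 R1"
        using R by (auto simp: annulus_def)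
      then show "R0\<^sup>2 * \<eta> (R0 *\<^sub>R e_R \<theta>) * e_R \<theta> $ j = R1\<^sup>2 * \<eta> (R1 *\<^sub>R e_R \<theta>) * e_R \<theta> $ j"
        using C1c_eq_0[OF \<eta>] by simp
    qed (use R in simp)
    have weak: "(LINT t:{0..2*pi}|lborel. g t $ i * deriv \<phi> t + g' t $ i * \<phi> t) = 0" if "smooth_circle \<phi>" for \<phi>
      by (rule W12_circle_weak_derivative_nth[OF g that])
    have d\<psi>: "((\<lambda>t. ?\<psi> (r, t)) has_real_derivative ?\<psi>' (r, \<theta>)) (at \<theta>)" for r \<theta>
    proof -
      have "((\<lambda>t. e_\<theta> t $ j) has_real_derivative - e_R \<theta> $ j) (at \<theta>)"
        unfolding has_real_derivative_iff_has_vector_derivative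
        using bounded_linear.has_vector_derivative[OF bounded_linear_vec_nth e_\<theta>_has_vector_derivative, of j \<theta>] by simp
      then show ?thesis
        using C1c_angular_derivative[OF \<eta>, of r \<theta>] unfolding has_real_derivative_iff_has_vector_derivative[symmetric]
        by (auto intro!: derivative_eq_intros simp: algebra_simps)
    qed
    have angular: "set_integrable lborel (polar_rect R0 R1) (\<lambda>p. ?\<psi>' p * g (snd p) $ i + ?\<psi> p * g' (snd p) $ i)"
       "(LINT p:polar_rect R0 R1|lborel. ?\<psi>' p * g (snd p) $ i + ?\<psi> p * g' (snd p) $ i) = 0"
      by (rule set_integrable_polar_rect_weak[OF int weak c(2,3) d\<psi>] set_integral_polar_rect_weak[OF int weak c(2,3) d\<psi>];
          simp add: e_periodic)+
    have eq: "(\<lambda>p. ?x p + ?y p) = (\<lambda>p. ?c p * g (snd p) $ i + (?\<psi>' p * g (snd p) $ i + ?\<psi> p * g' (snd p) $ i))"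
      unfolding D D' by (simp add: algebra_simps power2_eq_square)
    have "(LINT p:polar_rect R0 R1|lborel. ?x p + ?y p) = 0"
      unfolding eq set_integral_add(2)[OF rect(1)[OF c(1)] angular(1)] radial angular(2) by simp
    then have "(LINT p:polar_rect R0 R1|lborel. ?x p) + (LINT p:polar_rect R0 R1|lborel. ?y p) = 0"
      unfolding set_integral_add(2)[OF ix iy] .
    with X Y show "(LINT x:annulus R0 R1|lborel. ?X x) = - (LINT x:annulus R0 R1|lborel. ?Y x)"
      by simp
  }
qed

section \<open>The equilibrium equation in polar and in Cartesian form\<close>

theorem proposition3p4:
  fixes h :: "real \<Rightarrow> ennreal" and g g' :: "real \<Rightarrow> real^2" and R0 R1 :: real
    and d :: "real \<Rightarrow> real"
  assumes h: "admissible_h h"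
    and g: "W12_circle g g'"
    and fin: "I_energy h g g' < \<infinity>"
    and d: "\<And>\<theta>. d \<theta> = det (grad_one_hom g g' \<theta>)"
    and eq1_integrable: "\<And>\<phi>. smooth_circle \<phi> \<Longrightarrow>
          set_integrable lborel {0..2*pi}
            (\<lambda>\<theta>. (f_aux h (d \<theta>) + (norm (g' \<theta>))\<^sup>2 / 2 - (norm (g \<theta>))\<^sup>2 / 2) * deriv \<phi> \<theta>)"
    and eq1: "\<And>\<phi>. smooth_circle \<phi> \<Longrightarrow>
          (LINT \<theta>:{0..2*pi}|lborel.
            (f_aux h (d \<theta>) + (norm (g' \<theta>))\<^sup>2 / 2 - (norm (g \<theta>))\<^sup>2 / 2) * deriv \<phi> \<theta>) = 0"
    and eq2_integrable: "\<And>\<phi>. smooth_circle \<phi> \<Longrightarrow>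
          set_integrable lborel {0..2*pi}
            (\<lambda>\<theta>. ((norm (g' \<theta>))\<^sup>2 + (norm (g \<theta>))\<^sup>2 + 2 * d \<theta> * deriv (real_val h) (d \<theta>)) * \<phi> \<theta>
               + (g' \<theta> \<bullet> g \<theta>) * deriv \<phi> \<theta>)"
    and eq2: "\<And>\<phi>. smooth_circle \<phi> \<Longrightarrow>
          (LINT \<theta>:{0..2*pi}|lborel.
            ((norm (g' \<theta>))\<^sup>2 + (norm (g \<theta>))\<^sup>2 + 2 * d \<theta> * deriv (real_val h) (d \<theta>)) * \<phi> \<theta>
               + (g' \<theta> \<bullet> g \<theta>) * deriv \<phi> \<theta>) = 0"
    and R: "0 < R0" "R0 < R1"
  shows "(\<forall>\<Phi>\<in>C1c (annulus R0 R1).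
           let F = grad_one_hom g g';
               integrand = (\<lambda>(R, \<theta>).
                 ((M h (F \<theta>) *v e_R \<theta> + (2 * real_val (W h) (F \<theta>)) *\<^sub>R e_R \<theta>) \<bullet> \<Phi> (R *\<^sub>R e_R \<theta>)
                   + (M h (F \<theta>) *v e_\<theta> \<theta>) \<bullet> vector_derivative (\<lambda>t. \<Phi> (R *\<^sub>R e_R t)) (at \<theta>)) / R\<^sup>2)
           in set_integrable lborel ({R0<..<R1} \<times> {0..2*pi}) integrand
              \<and> (LINT p:{R0<..<R1} \<times> {0..2*pi}|lborel. integrand p) = 0)
         \<and> equilibrium_solution h (annulus R0 R1) (one_hom g)"
proof -
  define F where "F = grad_one_hom g g'"
  define A where "A \<theta> = f_aux h (d \<theta>) + (norm (g' \<theta>))\<^sup>2 / 2 - (norm (g \<theta>))\<^sup>2 / 2" for \<theta>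
  define B where "B \<theta> = g' \<theta> \<bullet> g \<theta>" for \<theta>
  define C where "C \<theta> = (norm (g' \<theta>))\<^sup>2 + (norm (g \<theta>))\<^sup>2 + 2 * d \<theta> * deriv (real_val h) (d \<theta>)" for \<theta>
  let ?P = "\<lambda>p. fst p *\<^sub>R e_R (snd p)"
  have meas: "g \<in> borel_measurable borel" "g' \<in> borel_measurable borel"
    and sq: "set_integrable lborel {0..2*pi} (\<lambda>\<theta>. (norm (g \<theta>))\<^sup>2)" "set_integrable lborel {0..2*pi} (\<lambda>\<theta>. (norm (g' \<theta>))\<^sup>2)"
    using g by (auto simp: W12_circle_def)
  have F_meas [measurable]: "F \<in> borel_measurable borel"
    unfolding F_def by (rule borel_measurable_grad_one_hom[OF meas])
  note [measurable] = meas borel_measurable_M[OF h] borel_measurable_real_val_W[OF h]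
  have B: "set_integrable lborel {0..2*pi} B"
    unfolding B_def[abs_def] by (rule set_integrable_inner_square_integrable[OF sq meas])
  \<comment> \<open>The constant test function 1 has zero derivative and isolates \<open>C\<close>
    in the second equation.\<close>
  have C: "set_integrable lborel {0..2*pi} C"
    using eq2_integrable[OF trig_polynomial_smooth_circle[OF trig_polynomial.const[of 1]]]
    by (simp add: C_def[abs_def])
  have hd: "set_integrable lborel {0..2*pi} (\<lambda>\<theta>. real_val h (d \<theta>))"
    unfolding d by (rule I_energy_set_integrable_h[OF h fin meas])
  have A: "set_integrable lborel {0..2*pi} A"
  proof -
    \<comment> \<open>No single test function isolates \<open>A\<close> in the first equation, since
      the derivative of a periodic function has a zero. This identity expresses \<open>A\<close>
      through functions already known to be integrable.\<close>
    have A_eq: "A = (\<lambda>\<theta>. C \<theta> / 2 - (norm (g \<theta>))\<^sup>2 - real_val h (d \<theta>))"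
      by (simp add: A_def C_def f_aux_def fun_eq_iff field_simps)
    show ?thesis
      unfolding A_eq by (intro set_integral_diff(1) set_integrable_divide C sq hd)
  qed
  have weakA: "(LINT t:{0..2*pi}|lborel. A t * deriv \<phi> t) = 0" if "smooth_circle \<phi>" for \<phi>
    using eq1[OF that] by (simp add: A_def)
  have weakBC: "(LINT t:{0..2*pi}|lborel. B t * deriv \<phi> t + C t * \<phi> t) = 0" if "smooth_circle \<phi>" for \<phi>
    using eq2[OF that] by (simp add: B_def C_def add.commute)
  have det_pos: "AE p in lborel. p \<in> polar_rect R0 R1 \<longrightarrow> 0 < det (F (snd p))"
    using AE_snd_lborel[OF I_energy_det_pos[OF h fin meas]]
    by eventually_elim (auto simp: F_def mem_Times_iff)
  define J where "J = polar_density A B C"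
  have J_eq: "((M h (F (snd p)) *v e_R (snd p) + (2 * real_val (W h) (F (snd p))) *\<^sub>R e_R (snd p)) \<bullet> \<Phi> (?P p)
      + (M h (F (snd p)) *v e_\<theta> (snd p)) \<bullet> frechet_derivative \<Phi> (at (?P p)) (fst p *\<^sub>R e_\<theta> (snd p))) / (fst p)\<^sup>2 = J \<Phi> p"
    if "0 < det (F (snd p))" for p \<Phi>
    using polar_integrand_eq[OF h that[unfolded F_def], of \<Phi>]
    unfolding J_def A_def[abs_def] B_def[abs_def] C_def[abs_def] d F_def .
  have polar: "let F = grad_one_hom g g';
               integrand = (\<lambda>(R, \<theta>).
                 ((M h (F \<theta>) *v e_R \<theta> + (2 * real_val (W h) (F \<theta>)) *\<^sub>R e_R \<theta>) \<bullet> \<Phi> (R *\<^sub>R e_R \<theta>)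
                   + (M h (F \<theta>) *v e_\<theta> \<theta>) \<bullet> vector_derivative (\<lambda>t. \<Phi> (R *\<^sub>R e_R t)) (at \<theta>)) / R\<^sup>2)
           in set_integrable lborel ({R0<..<R1} \<times> {0..2*pi}) integrand
              \<and> (LINT p:{R0<..<R1} \<times> {0..2*pi}|lborel. integrand p) = 0"
    if \<Phi>: "\<Phi> \<in> C1c (annulus R0 R1)" for \<Phi>
  proof -
    note [measurable] = C1c_borel_measurable[OF \<Phi>]
    let ?I = "\<lambda>p. ((M h (F (snd p)) *v e_R (snd p) + (2 * real_val (W h) (F (snd p))) *\<^sub>R e_R (snd p)) \<bullet> \<Phi> (?P p)
      + (M h (F (snd p)) *v e_\<theta> (snd p)) \<bullet> frechet_derivative \<Phi> (at (?P p)) (fst p *\<^sub>R e_\<theta> (snd p))) / (fst p)\<^sup>2"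
    have "?I \<in> borel_measurable lborel"
      by measurable
    moreover have "AE p in lborel. p \<in> polar_rect R0 R1 \<longrightarrow> ?I p = J \<Phi> p"
      using det_pos by eventually_elim (simp add: J_eq)
    ultimately have "set_integrable lborel (polar_rect R0 R1) ?I" "(LINT p:polar_rect R0 R1|lborel. ?I p) = 0"
      using set_integrable_congI_AE[OF polar_density_integrable[OF \<Phi> R(1) A B C weakA weakBC], of R1 ?I]
        polar_density_integral[OF \<Phi> R(1) A B C weakA weakBC, of R1]
      by (simp_all add: J_def)
    then show ?thesis
      unfolding Let_def case_prod_unfold F_def[symmetric]
        vector_derivative_at[OF C1c_angular_derivative[OF \<Phi>]]
      by simp
  qed
  have "equilibrium_solution h (annulus R0 R1) (one_hom g)"
    unfolding equilibrium_solution_def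
  proof (intro exI conjI ballI)
    let ?G = "\<lambda>x. F (polar_angle x)"
    show "has_weak_gradient (one_hom g) ?G (annulus R0 R1)"
      unfolding F_def by (rule one_hom_has_weak_gradient[OF g R])
    show "E_energy h (annulus R0 R1) ?G < \<infinity>"
      unfolding F_def by (rule E_energy_one_hom_finite[OF h fin R(1) meas])
    fix \<Phi> :: "real^2 \<Rightarrow> real^2" assume \<Phi>: "\<Phi> \<in> C1c (annulus R0 R1)"
    note [measurable] = C1c_borel_measurable[OF \<Phi>]
    let ?D = "\<lambda>p. frechet_derivative \<Phi> (at (?P p))"
    let ?I = "\<lambda>x. ((2 * real_val (W h) (?G x) / norm x ^ 4) *\<^sub>R x) \<bullet> \<Phi> x
                + (1 / (norm x)\<^sup>2) * (M h (?G x) \<bullet> jacobian \<Phi> (at x))"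
    have [measurable]: "(\<lambda>x. jacobian \<Phi> (at x)) \<in> borel_measurable borel"
      unfolding jacobian_def matrix_def by (intro borel_measurable_vec2I) simp
    have I_meas: "?I \<in> borel_measurable borel"
      by measurable
    have cont: "continuous_on S (\<lambda>p. \<Phi> (?P p))" "continuous_on S (\<lambda>p. ?D p (e_R (snd p)))" for S
      by (intro C1c_continuous[OF \<Phi>] C1c_continuous_derivative[OF \<Phi>] continuous_intros)+
    \<comment> \<open>The \<open>R\<close>-derivative of \<open>(v \<bullet> \<Phi>) / R\<close>,
      for a frame vector \<open>v\<close> that depends on the angle only.\<close>
    let ?c = "\<lambda>v p. (v (snd p) \<bullet> ?D p (e_R (snd p))) / fst p - (v (snd p) \<bullet> \<Phi> (?P p)) / (fst p)\<^sup>2"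
    have nz: "\<forall>p\<in>{R0..R1} \<times> {0..2*pi}. fst p \<noteq> 0" "\<forall>p\<in>{R0..R1} \<times> {0..2*pi}. (fst p)\<^sup>2 \<noteq> 0"
      using R by auto
    have c: "continuous_on ({R0..R1} \<times> {0..2*pi}) (?c e_R)" "continuous_on ({R0..R1} \<times> {0..2*pi}) (?c e_\<theta>)"
      by (intro continuous_intros cont nz)+
    \<comment> \<open>The radial diagonal entry of \<open>M\<close>: almost everywhere, M e_R = k
      e_R + B e_\<theta>.\<close>
    define k where "k \<theta> = A \<theta> + (norm (g \<theta>))\<^sup>2 - (norm (g' \<theta>))\<^sup>2" for \<theta>
    have k: "set_integrable lborel {0..2*pi} k"
      unfolding k_def[abs_def] by (intro set_integral_add(1) set_integral_diff(1) A sq)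
    have radial: "(LINT p:polar_rect R0 R1|lborel. ?c v p * l (snd p)) = 0"
      if "set_integrable lborel {0..2*pi} l" "continuous_on ({R0..R1} \<times> {0..2*pi}) (?c v)" for l v
    proof (rule set_integral_polar_rect_radial_derivative[OF that])
      fix r \<theta> assume "r \<in> {R0..R1}"
      then have "r \<noteq> 0" using R by auto
      from inner_radial_derivative[OF \<Phi> this]
      show "((\<lambda>r. (v \<theta> \<bullet> \<Phi> (r *\<^sub>R e_R \<theta>)) / r) has_real_derivative ?c v (r, \<theta>)) (at r)"
        by simp
    next
      fix \<theta>
      have "R0 *\<^sub>R e_R \<theta> \<notin> annulus R0 R1" "R1 *\<^sub>R e_R \<theta> \<notin> annulus R0 R1"
        using R by (auto simp: annulus_def)
      then show "(v \<theta> \<bullet> \<Phi> (R0 *\<^sub>R e_R \<theta>)) / R0 = (v \<theta> \<bullet> \<Phi> (R1 *\<^sub>R e_R \<theta>)) / R1"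
        using C1c_eq_0[OF \<Phi>] by simp
    qed (use R in simp)
    let ?N = "\<lambda>p. J \<Phi> p + (?c e_R p * k (snd p) + ?c e_\<theta> p * B (snd p))"
    note i1 = polar_density_integrable[OF \<Phi> R(1) A B C weakA weakBC, of R1, folded J_def]
    note i2 = set_integrable_polar_rect[OF k c(1)] and i3 = set_integrable_polar_rect[OF B c(2)]
    note i23 = set_integral_add(1)[OF i2 i3]
    have N: "set_integrable lborel (polar_rect R0 R1) ?N"
      by (rule set_integral_add(1)[OF i1 i23])
    have N0: "(LINT p:polar_rect R0 R1|lborel. ?N p) = 0"
    proof -
      have "(LINT p:polar_rect R0 R1|lborel. ?N p) = (LINT p:polar_rect R0 R1|lborel. J \<Phi> p)
          + (LINT p:polar_rect R0 R1|lborel. ?c e_R p * k (snd p) + ?c e_\<theta> p * B (snd p))"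
        by (rule set_integral_add(2)[OF i1 i23])
      also have "(LINT p:polar_rect R0 R1|lborel. ?c e_R p * k (snd p) + ?c e_\<theta> p * B (snd p))
          = (LINT p:polar_rect R0 R1|lborel. ?c e_R p * k (snd p)) + (LINT p:polar_rect R0 R1|lborel. ?c e_\<theta> p * B (snd p))"
        by (rule set_integral_add(2)[OF i2 i3])
      also have "(LINT p:polar_rect R0 R1|lborel. ?c e_R p * k (snd p)) = 0"
        by (rule radial[OF k c(1)])
      also have "(LINT p:polar_rect R0 R1|lborel. ?c e_\<theta> p * B (snd p)) = 0"
        by (rule radial[OF B c(2)])
      also have "(LINT p:polar_rect R0 R1|lborel. J \<Phi> p) = 0"
        unfolding J_def by (rule polar_density_integral[OF \<Phi> R(1) A B C weakA weakBC])
      finally show ?thesis by simp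
    qed
    have m: "(\<lambda>p. fst p *\<^sub>R ?I (?P p)) \<in> borel_measurable lborel"
      using measurable_compose[OF polar_map_measurable I_meas] by simp
    have eq: "AE p in lborel. p \<in> polar_rect R0 R1 \<longrightarrow> fst p *\<^sub>R ?I (?P p) = ?N p"
      using det_pos AE_polar_angle[OF R(1), of R1]
    proof eventually_elim
      case (elim p)
      show ?case
      proof
        assume p: "p \<in> polar_rect R0 R1"
        define r where "r = fst p"
        define \<theta> where "\<theta> = snd p"
        have det: "0 < det (F \<theta>)" and angle: "polar_angle (?P p) = \<theta>" and r: "0 < r"
          using elim p R by (auto simp: \<theta>_def r_def mem_Times_iff)
        interpret D: bounded_linear "?D p"
          by (rule has_derivative_bounded_linear[OF C1c_has_derivative[OF \<Phi>]])
        have jac: "jacobian \<Phi> (at (?P p)) *v w = ?D p w" for w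
          using frechet_derivative_at[OF jacobian_works[THEN iffD1, OF differentiableI[OF C1c_has_derivative[OF \<Phi>]]]]
          by (rule fun_cong)
        have Mk: "(M h (F \<theta>) *v e_R \<theta>) \<bullet> w = (e_R \<theta> \<bullet> w) * k \<theta> + (e_\<theta> \<theta> \<bullet> w) * B \<theta>" for w
          using M_e_R_inner[OF h det[unfolded F_def] refl refl refl, of w]
          by (simp add: F_def k_def A_def B_def d)
        \<comment> \<open>The prefactor is the area element. In the frame the Jacobian of \<Phi> has
          columns Phi_R and Phi_\<theta> / R; the latter is the derivative along the unit vector
          \<open>e_\<theta>\<close>, whereas \<open>J\<close> uses the direction
          \<open>R *\<^sub>R e_\<theta>\<close>, whence the different powers of
          \<open>r\<close>.\<close>
        have "fst p *\<^sub>R ?I (?P p) = (2 * real_val (W h) (F \<theta>) * (e_R \<theta> \<bullet> \<Phi> (?P p))) / r\<^sup>2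
            + ((M h (F \<theta>) *v e_R \<theta>) \<bullet> ?D p (e_R \<theta>) + (M h (F \<theta>) *v e_\<theta> \<theta>) \<bullet> ?D p (e_\<theta> \<theta>)) / r"
          unfolding matrix_inner_frame[of _ _ \<theta>] jac angle
          using r by (simp add: r_def[symmetric] \<theta>_def[symmetric] field_simps power2_eq_square power4_eq_xxxx)
        \<comment> \<open>Adding and subtracting M e_R . Phi / r^2 completes the polar density and
          leaves M e_R against the radial derivative of Phi / R.\<close>
        also have "\<dots> = J \<Phi> p + ((M h (F \<theta>) *v e_R \<theta>) \<bullet> ?D p (e_R \<theta>) / r - (M h (F \<theta>) *v e_R \<theta>) \<bullet> \<Phi> (?P p) / r\<^sup>2)"
          unfolding J_eq[OF det[unfolded \<theta>_def], symmetric] D.scaleR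
          using r by (simp add: r_def[symmetric] \<theta>_def[symmetric] inner_add_left add_divide_distrib power2_eq_square)
        also have "\<dots> = ?N p"
          unfolding Mk by (simp add: r_def[symmetric] \<theta>_def[symmetric] add_divide_distrib algebra_simps)
        finally show "fst p *\<^sub>R ?I (?P p) = ?N p" .
      qed
    qed
    have "set_integrable lborel (annulus R0 R1) ?I"
      unfolding set_integrable_polar[OF R(1) I_meas]
      by (rule set_integrable_congI_AE(1)[OF N _ m eq]) simp
    moreover have "(LINT x:annulus R0 R1|lborel. ?I x) = 0"
      unfolding set_integral_polar[OF R(1) I_meas]
      by (rule trans[OF set_integrable_congI_AE(2)[OF N _ m eq] N0]) simp
    ultimately show "let integrand = ?I
          in set_integrable lborel (annulus R0 R1) integrand \<and> (LINT x:annulus R0 R1|lborel. integrand x) = 0"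
      by (simp only: Let_def simp_thms)
  qed
  with polar show ?thesis
    by blast
qed

end
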